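(* Let $\omega_1=z_2(z_3v_{24}-2z_4v_{23})$, $\omega_2=z_3(3z_4v_{13}-2z_3v_{14})$, $\omega_3=z_4(z_2v_{14}-3z_4v_{12})$, where $v_{ij}=z_i\,dz_j-z_j\,dz_i$, and let $P$ be the group of upper triangular matrices in $SL_4(\mathbb{C})$. Then there are the following isomorphisms of locally closed varieties: $$P\cdot(\omega_1+\omega_2)\cong\mathbb{A}^5\times\big(\overline{L}_u-\{(0:0:1:0),(0:0:0:1)\}\big)\subset Z_1,$$ $$P\cdot(\omega_2+\omega_3)\cong\mathbb{A}^5\times\big(\overline{L}_w-\{(0:0:0:1),(1:0:0:0)\}\big)\subset Z_3,$$ $$P\cdot(\omega_1+\omega_3)\cong\mathbb{A}^5\times\big(C_\infty-\{(0:0:1:0),(1:0:0:0)\}\big)\subset Z_2.$$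
   Context: $SL_4(\mathbb{C})$ acts by linear change of coordinates on 1-forms $\sum_{i=1}^4A_i\,dz_i$ ($A_i\in\mathbb{C}[z_1,\dots,z_4]$ homogeneous of degree $3$, $\sum_i z_iA_i=0$) and on the projectivization of the space of such forms ($g^{-1}$ acts by pull-back under $z\mapsto gz$). $P\cdot\eta$ denotes the $P$-orbit of the projective class of $\eta$. The form $\omega=\omega_1+\omega_2+\omega_3$ defines the exceptional foliation $\mathcal{F}_\omega$. Let $(u:v:w:z)$ be homogeneous coordinates on $\mathbb{P}^3$ and $\mathbb{V}(uw-v^2)\subset\mathbb{P}^3$ the quadric cone. Put $\overline{L}_u=\{(0:0:w:z)\}$, $\overline{L}_w=\{(u:0:0:z)\}$, $C_\infty=\{(u:v:w:0): uw=v^2\}$, all contained in $\mathbb{V}(uw-v^2)$, and $$Z_1=\mathbb{P}^5\times\overline{L}_u,\quad Z_2=\mathbb{P}^5\times C_\infty,\quad Z_3=\mathbb{P}^5\times\overline{L}_w,$$ where $\mathbb{A}^5\subset\mathbb{P}^5$ is the standard affine chart. In the paper $\overline{P\cdot\omega}$ is identified with $\mathbb{P}^5\times\mathbb{V}(uw-v^2)$, and $Z_1,Z_2,Z_3$ with irreducible components of the boundary $\overline{P\cdot\omega}\setminus(P\cdot\omega)$. On the open orbit the identification $P\cdot\omega\cong P/G\cong\mathbb{A}^5\times\{(u,v,w)\in\mathbb{C}^3:uw=v^2,\ uw\ne 0\}$ (with $G$ the stabilizer of $[\omega]$ in $SL_4(\mathbb{C})$, which is contained in $P$) is as follows. Write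 $p\in P$ as $p=xt$ with $x=(x_{ij})$ unipotent upper triangular and $t=\mathrm{diag}(a_1,a_2,a_3,a_4)$. Then $pG$ is sent to the pair consisting of $$\Big(x_{13}-\tfrac{x_{12}^2}{2},\ x_{14}-x_{12}x_{13}+\tfrac{x_{12}^3}{3},\ x_{23}-x_{12},\ x_{24}-x_{12}x_{23}+\tfrac{x_{12}^2}{2},\ x_{34}-x_{12}\Big)\in\mathbb{A}^5$$ and $(u,v,w)=(a^2,ab,b^2)$, where $a=a_1a_2^{-3}$, $b=a_2a_3$. *)

theory Defs
  imports "HOL-Analysis.Analysis" "HOL-Library.Function_Algebras"
begin

section \<open>Locally closed subvarieties of (multi)projective spaces\<close>

text \<open>A point of a projective or multiprojective space is the set of all its tuples of homogeneous
  coordinates, as an element (of type \<open>'v\<close>) of the product of the underlying vector spaces.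
  \<open>coord A e\<close> is the set of homogeneous coordinates of degree \<open>e\<close>; the degree type is
  \<open>nat\<close> for a projective space and \<open>nat \<times> nat\<close> for a product of two.\<close>

record ('v, 'd) multiproj =
  points :: "'v set set"
  coord :: "'d \<Rightarrow> ('v \<Rightarrow> complex) set"

inductive homog :: "('v, 'd::comm_monoid_add) multiproj \<Rightarrow> 'd \<Rightarrow> ('v \<Rightarrow> complex) \<Rightarrow> bool"
  for A where
  const: "homog A 0 (\<lambda>x. c)"
| mult: "l \<in> coord A e \<Longrightarrow> homog A d F \<Longrightarrow> homog A (e + d) (\<lambda>x. l x * F x)"
| add: "homog A d F \<Longrightarrow> homog A d G \<Longrightarrow> homog A d (\<lambda>x. F x + G x)"

definition zariski :: "('v, 'd::comm_monoid_add) multiproj \<Rightarrow> 'v set topology" where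
  "zariski A =
     topology_generated_by {{p \<in> points A. \<forall>x\<in>p. F x \<noteq> 0} | d F. homog A d F}"

definition locally_closed :: "('v, 'd::comm_monoid_add) multiproj \<Rightarrow> 'v set set \<Rightarrow> bool" where
  "locally_closed A X \<longleftrightarrow>
     (\<exists>U Z. openin (zariski A) U \<and> closedin (zariski A) Z \<and> X = U \<inter> Z)"

definition regular_on ::
  "('v, 'd::comm_monoid_add) multiproj \<Rightarrow> 'v set set \<Rightarrow> ('v set \<Rightarrow> complex) \<Rightarrow> bool" where
  "regular_on A V f \<longleftrightarrow>
     (\<forall>p\<in>V. \<exists>N d F G. openin (subtopology (zariski A) V) N \<and> p \<in> N \<and> homog A d F \<and> homog A d G \<and>
        (\<forall>q\<in>N. \<forall>x\<in>q. G x \<noteq> 0 \<and> f q = F x / G x))"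

definition variety_morphism ::
  "('v, 'd::comm_monoid_add) multiproj \<Rightarrow> 'v set set \<Rightarrow>
   ('w, 'e::comm_monoid_add) multiproj \<Rightarrow> 'w set set \<Rightarrow> ('v set \<Rightarrow> 'w set) \<Rightarrow> bool" where
  "variety_morphism A X B Y \<phi> \<longleftrightarrow>
     continuous_map (subtopology (zariski A) X) (subtopology (zariski B) Y) \<phi> \<and>
     (\<forall>V f. openin (subtopology (zariski B) Y) V \<and> regular_on B V f \<longrightarrow>
        regular_on A {p \<in> X. \<phi> p \<in> V} (f \<circ> \<phi>))"

definition isomorphic_varieties ::
  "('v, 'd::comm_monoid_add) multiproj \<Rightarrow> 'v set set \<Rightarrow>
   ('w, 'e::comm_monoid_add) multiproj \<Rightarrow> 'w set set \<Rightarrow> bool" where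
  "isomorphic_varieties A X B Y \<longleftrightarrow>
     locally_closed A X \<and> locally_closed B Y \<and>
     (\<exists>\<phi> \<psi>. variety_morphism A X B Y \<phi> \<and> variety_morphism B Y A X \<psi> \<and>
        (\<forall>p\<in>X. \<psi> (\<phi> p) = p) \<and> (\<forall>q\<in>Y. \<phi> (\<psi> q) = q))"


section \<open>Projective spaces and their products\<close>

text \<open>Below \<open>s\<close> is the scalar multiplication of a complex vector space. The homogeneous
  coordinates on \<open>\<P>(W)\<close> are all linear functionals; those of the whole type restrict
  onto the dual of a subspace \<open>W\<close>.\<close>

definition proj_class :: "(complex \<Rightarrow> 'v \<Rightarrow> 'v) \<Rightarrow> 'v \<Rightarrow> 'v set" where
  "proj_class s x = {s c x | c. c \<noteq> 0}"

definition linear_functionals ::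
  "(complex \<Rightarrow> 'v::ab_group_add \<Rightarrow> 'v) \<Rightarrow> ('v \<Rightarrow> complex) set" where
  "linear_functionals s = {l. Vector_Spaces.linear s (*) l}"

definition projective_space ::
  "(complex \<Rightarrow> 'v::ab_group_add \<Rightarrow> 'v) \<Rightarrow> 'v set \<Rightarrow> ('v, nat) multiproj" where
  "projective_space s W =
     \<lparr>points = proj_class s ` (W - {0}),
      coord = (\<lambda>d. if d = 1 then linear_functionals s else {})\<rparr>"

abbreviation Proj :: "(complex ^ 'n, nat) multiproj" where
  "Proj \<equiv> projective_space (*s) UNIV"

text \<open>The pair of points \<open>p\<close>, \<open>q\<close> is the point \<open>p \<times> q\<close> of the product.\<close>

definition point_prod :: "'v set set \<Rightarrow> 'w set set \<Rightarrow> ('v \<times> 'w) set set" (infixr \<open>\<boxtimes>\<close> 80) where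
  "X \<boxtimes> Y = {p \<times> q | p q. p \<in> X \<and> q \<in> Y}"

definition biprojective ::
  "('v, nat) multiproj \<Rightarrow> ('w, nat) multiproj \<Rightarrow> ('v \<times> 'w, nat \<times> nat) multiproj" where
  "biprojective A B =
     \<lparr>points = points A \<boxtimes> points B,
      coord = (\<lambda>d. if d = (1, 0) then (\<lambda>l. l \<circ> fst) ` coord A 1
                   else if d = (0, 1) then (\<lambda>l. l \<circ> snd) ` coord B 1 else {})\<rparr>"


section \<open>Twisted 1-forms and the orbits of the upper triangular group\<close>

text \<open>A 1-form is the function sending a point and a tangent vector to a number.\<close>

type_synonym one_form = "complex ^ 4 \<Rightarrow> complex ^ 4 \<Rightarrow> complex"

definition scale_form :: "complex \<Rightarrow> one_form \<Rightarrow> one_form" where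
  "scale_form c \<eta> = (\<lambda>z v. c * \<eta> z v)"

definition dz :: "4 \<Rightarrow> complex ^ 4 \<Rightarrow> complex" where
  "dz i v = v $ i"

definition twisted_forms :: "one_form set" where
  "twisted_forms =
     {\<lambda>z v. \<Sum>i\<in>UNIV. A i z * dz i v | A.
        (\<forall>i. homog (Proj :: (complex ^ 4, nat) multiproj) 3 (A i)) \<and>
        (\<forall>z. (\<Sum>i\<in>UNIV. z $ i * A i z) = 0)}"

abbreviation form_space :: "(one_form, nat) multiproj" where
  "form_space \<equiv> projective_space scale_form twisted_forms"

definition pullback :: "complex ^ 4 ^ 4 \<Rightarrow> one_form \<Rightarrow> one_form" where
  "pullback g \<eta> = (\<lambda>z v. \<eta> (g *v z) (g *v v))"

definition act :: "complex ^ 4 ^ 4 \<Rightarrow> one_form \<Rightarrow> one_form" where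
  "act g \<eta> = pullback (matrix_inv g) \<eta>"

text \<open>The indices are written out since \<open>4 = 0\<close> in the index type, so its order is
  not \<open>1 < 2 < 3 < 4\<close>.\<close>

definition P :: "(complex ^ 4 ^ 4) set" where
  "P = {g. det g = 1 \<and> g $ 2 $ 1 = 0 \<and> g $ 3 $ 1 = 0 \<and> g $ 3 $ 2 = 0 \<and>
           g $ 4 $ 1 = 0 \<and> g $ 4 $ 2 = 0 \<and> g $ 4 $ 3 = 0}"

definition P_orbit :: "one_form \<Rightarrow> one_form set set" where
  "P_orbit \<eta> = {proj_class scale_form (act g \<eta>) | g. g \<in> P}"

definition vf :: "4 \<Rightarrow> 4 \<Rightarrow> one_form" where
  "vf i j = (\<lambda>z v. z $ i * dz j v - z $ j * dz i v)"

definition \<omega>\<^sub>1 :: one_form where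
  "\<omega>\<^sub>1 = (\<lambda>z v. z $ 2 * (z $ 3 * vf 2 4 z v - 2 * z $ 4 * vf 2 3 z v))"

definition \<omega>\<^sub>2 :: one_form where
  "\<omega>\<^sub>2 = (\<lambda>z v. z $ 3 * (3 * z $ 4 * vf 1 3 z v - 2 * z $ 3 * vf 1 4 z v))"

definition \<omega>\<^sub>3 :: one_form where
  "\<omega>\<^sub>3 = (\<lambda>z v. z $ 4 * (z $ 2 * vf 1 4 z v - 3 * z $ 4 * vf 1 2 z v))"


section \<open>The boundary components\<close>

abbreviation P5 :: "(complex ^ 6) set set" where
  "P5 \<equiv> points Proj"

abbreviation P5_P3 :: "((complex ^ 6) \<times> (complex ^ 4), nat \<times> nat) multiproj" where
  "P5_P3 \<equiv> biprojective Proj Proj"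

definition A5 :: "(complex ^ 6) set set" where
  "A5 = {proj_class (*s) y | y. y $ 1 \<noteq> 0}"

definition pt :: "complex \<Rightarrow> complex \<Rightarrow> complex \<Rightarrow> complex \<Rightarrow> (complex ^ 4) set" where
  "pt u v w z = proj_class (*s) (vector [u, v, w, z])"

definition L\<^sub>u :: "(complex ^ 4) set set" where
  "L\<^sub>u = {pt 0 0 w z | w z. (w, z) \<noteq> (0, 0)}"

definition L\<^sub>w :: "(complex ^ 4) set set" where
  "L\<^sub>w = {pt u 0 0 z | u z. (u, z) \<noteq> (0, 0)}"

definition C_inf :: "(complex ^ 4) set set" where
  "C_inf = {pt u v w 0 | u v w. (u, v, w) \<noteq> (0, 0, 0) \<and> u * w = v\<^sup>2}"

definition Z\<^sub>1 :: "((complex ^ 6) \<times> (complex ^ 4)) set set" where "Z\<^sub>1 = P5 \<boxtimes> L\<^sub>u"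
definition Z\<^sub>2 :: "((complex ^ 6) \<times> (complex ^ 4)) set set" where "Z\<^sub>2 = P5 \<boxtimes> C_inf"
definition Z\<^sub>3 :: "((complex ^ 6) \<times> (complex ^ 4)) set set" where "Z\<^sub>3 = P5 \<boxtimes> L\<^sub>w"

end

theory Submission
  imports Defs
begin

text \<open>Modulo the one-parameter unipotent group fixing \<open>\<omega>\<^sub>i + \<omega>\<^sub>j\<close>, every element of \<open>P\<close> is a diagonal
  matrix times a unipotent matrix with one prescribed zero entry, and the diagonal matrices move
  \<open>\<omega>\<^sub>i + \<omega>\<^sub>j\<close> to all \<open>\<alpha> \<omega>\<^sub>i + \<beta> \<omega>\<^sub>j\<close> with \<open>\<alpha> \<beta> \<noteq> 0\<close>, up to a scalar. This gives a polynomial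
  parametrisation of the orbit by the affine space of unipotent matrices times the points
  \<open>(\<alpha> : \<beta>)\<close>. It is inverted by homogeneous polynomials in seven of the coefficients of \<open>dz\<^sub>4\<close>, since
  these determine the unknowns one after the other.\<close>

section \<open>Homogeneous functions and lifts\<close>

text \<open>Points are classes of homogeneous coordinates and morphisms are tested on regular
  functions, so affine charts would have to be glued. A single pair of homogeneous lifts avoids
  this. Placing the extra coordinate of the five-dimensional projective space on the whole diagonal
  of the unipotent matrix makes all entries linear, and the parametrisation becomes bihomogeneous of
  degree (4, 1): three factors \<open>z\<close> and one \<open>v\<close>, each transformed by the
  matrix, and one factor \<alpha> or \<beta>. In the other direction the equations are triangular:
  with l on the diagonal, each new matrix entry is multiplied by a nonzero constant times \<alpha>
  l^3 or \<beta> l^3, so all denominators are invertible where \<alpha> \<beta> l \<noteq> 0. The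
  forms are weight vectors: diag(a, b, c, d) multiplies \<open>\<omega>\<^sub>1\<close>,
  \<open>\<omega>\<^sub>2\<close>, \<open>\<omega>\<^sub>3\<close> by b^2 c d, a c^2 d, a b d^2. The
  pair (\<alpha> : \<beta>) is the coordinate on each of the two lines and becomes (\<alpha>^2 :
  \<alpha> \<beta> : \<beta>^2) on the conic.\<close>

lemma homog_coord: "l \<in> coord A e \<Longrightarrow> homog A e l"
  using homog.mult[OF _ homog.const[of A 1], of l e] by simp

lemma homog_cmult: "homog A d F \<Longrightarrow> homog A d (\<lambda>x. c * F x)"
proof (induction rule: homog.induct)
  case (const c')
  show ?case by (rule homog.const)
next
  case (mult l e d F)
  then show ?case
    using homog.mult[of l A e d "\<lambda>x. c * F x"] by (simp add: mult.left_commute)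
next
  case (add d F G)
  then show ?case
    using homog.add[of A d "\<lambda>x. c * F x" "\<lambda>x. c * G x"] by (simp add: distrib_left)
qed

lemma homog_uminus: "homog A d F \<Longrightarrow> homog A d (\<lambda>x. - F x)"
  using homog_cmult[of A d F "-1"] by simp

lemma homog_diff: "homog A d F \<Longrightarrow> homog A d G \<Longrightarrow> homog A d (\<lambda>x. F x - G x)"
  using homog.add[of A d F "\<lambda>x. - G x"] homog_uminus[of A d G] by simp

text \<open>Only products with a coordinate are built into \<open>homog\<close>, so general products
  need an induction on one factor.\<close>

lemma homog_times: "homog A d F \<Longrightarrow> homog A e G \<Longrightarrow> homog A (d + e) (\<lambda>x. F x * G x)"
proof (induction rule: homog.induct)
  case (const c)
  then show ?case by (simp add: homog_cmult)
next
  case (mult l e' d F)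
  then show ?case
    using homog.mult[of l A e' "d + e" "\<lambda>x. F x * G x"] by (simp add: ac_simps)
next
  case (add d F F')
  then show ?case
    using homog.add[of A "d + e" "\<lambda>x. F x * G x" "\<lambda>x. F' x * G x"]
    by (simp add: distrib_right)
qed

lemma homog_divide: "homog A d F \<Longrightarrow> homog A d (\<lambda>x. F x / c)"
  using homog_cmult[of A d F "1 / c"] by simp

text \<open>A map of the ambient vector spaces all of whose coordinates are homogeneous,
  \<open>D e\<close> being the degree of the coordinates of degree \<open>e\<close>.\<close>

definition homog_lift ::
  "('v, 'd::comm_monoid_add) multiproj \<Rightarrow> ('w, 'e::comm_monoid_add) multiproj \<Rightarrow>
   ('e \<Rightarrow> 'd) \<Rightarrow> ('v \<Rightarrow> 'w) \<Rightarrow> bool" where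
  "homog_lift A B D \<Phi> \<longleftrightarrow>
     D 0 = 0 \<and> (\<forall>d e. D (d + e) = D d + D e) \<and>
     (\<forall>e. \<forall>l\<in>coord B e. homog A (D e) (\<lambda>x. l (\<Phi> x)))"

lemma homog_comp_lift:
  assumes "homog_lift A B D \<Phi>" "homog B d F"
  shows "homog A (D d) (\<lambda>x. F (\<Phi> x))"
  using assms(2)
proof (induction rule: homog.induct)
  case (const c)
  show ?case using assms(1) homog.const[of A c] by (simp add: homog_lift_def)
next
  case (mult l e d F)
  then show ?case
    using assms(1) homog_times[of A "D e" "\<lambda>x. l (\<Phi> x)" "D d" "\<lambda>x. F (\<Phi> x)"]
    by (simp add: homog_lift_def)
next
  case (add d F G)
  then show ?case using homog.add by blast
qed

text \<open>The function \<open>h\<close> is a character of the grading: c^d on a projective space,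
  c^i b^j in bidegree (i, j) on a product. In this form one argument serves both kinds of
  space.\<close>

definition graded_rescaling ::
  "('v, 'd::comm_monoid_add) multiproj \<Rightarrow> 'v \<Rightarrow> 'v \<Rightarrow> ('d \<Rightarrow> complex) \<Rightarrow> bool" where
  "graded_rescaling A x y h \<longleftrightarrow>
     h 0 = 1 \<and> (\<forall>d e. h (d + e) = h d * h e) \<and> (\<forall>d. h d \<noteq> 0) \<and>
     (\<forall>d. \<forall>l\<in>coord A d. l y = h d * l x)"

lemma graded_rescaling_homog:
  assumes "graded_rescaling A x y h" "homog A d F"
  shows "F y = h d * F x"
  using assms(2)
  by (induction rule: homog.induct)
    (use assms(1) in \<open>simp_all add: graded_rescaling_def distrib_left\<close>)

text \<open>\<open>multiproj\<close> is a bare record. This singles out the records whose points are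
  nonempty disjoint sets of coordinates on which the vanishing of a homogeneous function is well
  defined.\<close>

definition multigraded :: "('v, 'd::comm_monoid_add) multiproj \<Rightarrow> bool" where
  "multigraded A \<longleftrightarrow>
     (\<forall>p\<in>points A. p \<noteq> {}) \<and>
     (\<forall>p\<in>points A. \<forall>q\<in>points A. p \<inter> q \<noteq> {} \<longrightarrow> p = q) \<and>
     (\<forall>p\<in>points A. \<forall>x\<in>p. \<forall>y\<in>p. \<exists>h. graded_rescaling A x y h)"

lemma multigraded_nonempty:
  assumes "multigraded A" "p \<in> points A"
  obtains x where "x \<in> p"
proof -
  have "p \<noteq> {}" using assms by (simp add: multigraded_def)
  then show thesis using that by blast
qed

lemma multigraded_eq:
  assumes "multigraded A" "p \<in> points A" "q \<in> points A" "p \<inter> q \<noteq> {}"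
  shows "p = q"
  using assms by (simp add: multigraded_def)

lemma multigraded_rescaling:
  assumes "multigraded A" "p \<in> points A" "x \<in> p" "y \<in> p"
  obtains h where "graded_rescaling A x y h"
proof -
  have "\<exists>h. graded_rescaling A x y h" using assms by (simp add: multigraded_def)
  then show thesis using that by blast
qed

lemma homog_zero_iff:
  assumes "multigraded A" "p \<in> points A" "x \<in> p" "y \<in> p" "homog A d F"
  shows "F x = 0 \<longleftrightarrow> F y = 0"
proof -
  obtain h where h: "graded_rescaling A x y h"
    using multigraded_rescaling[OF assms(1-4)] .
  then have "h d \<noteq> 0" by (simp add: graded_rescaling_def)
  then show ?thesis using graded_rescaling_homog[OF h assms(5)] by simp
qed

lemma homog_zero_all_iff:
  assumes "multigraded A" "p \<in> points A" "x \<in> p" "homog A d F"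
  shows "(\<forall>y\<in>p. F y = 0) \<longleftrightarrow> F x = 0" "(\<forall>y\<in>p. F y \<noteq> 0) \<longleftrightarrow> F x \<noteq> 0"
  using homog_zero_iff[OF assms(1,2,3) _ assms(4)] assms(3) by blast+

section \<open>The Zariski topology\<close>

lemma openin_zariski_nonzero:
  "homog A d F \<Longrightarrow> openin (zariski A) {p \<in> points A. \<forall>x\<in>p. F x \<noteq> 0}"
  unfolding zariski_def by (rule topology_generated_by_Basis) blast

lemma nonzero_loci_cover:
  "\<Union> {{p \<in> points A. \<forall>x\<in>p. F x \<noteq> 0} | d F. homog A d F} = points A"
proof
  show "points A \<subseteq> \<Union> {{p \<in> points A. \<forall>x\<in>p. F x \<noteq> 0} | d F. homog A d F}"
  proof
    fix p assume "p \<in> points A"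
    then have "p \<in> {p \<in> points A. \<forall>x\<in>p. 1 \<noteq> (0::complex)}" by simp
    then show "p \<in> \<Union> {{p \<in> points A. \<forall>x\<in>p. F x \<noteq> 0} | d F. homog A d F}"
      by (rule UnionI[rotated])
        (intro CollectI exI[of _ 0] exI[of _ "\<lambda>_. 1"] conjI refl homog.const)
  qed
qed auto

lemma topspace_zariski [simp]: "topspace (zariski A) = points A"
  unfolding zariski_def topology_generated_by_topspace by (rule nonzero_loci_cover)

text \<open>The topology is generated by nonvanishing loci, and a zero locus is the complement of
  one because a homogeneous function vanishes at all coordinates of a point or at none.\<close>

lemma closedin_zariski_zero:
  assumes "multigraded A" "homog A d F"
  shows "closedin (zariski A) {p \<in> points A. \<forall>x\<in>p. F x = 0}"
proof -
  have "points A - {p \<in> points A. \<forall>x\<in>p. F x = 0} = {p \<in> points A. \<forall>x\<in>p. F x \<noteq> 0}"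
  proof -
    have "(\<not> (\<forall>x\<in>p. F x = 0)) \<longleftrightarrow> (\<forall>x\<in>p. F x \<noteq> 0)" if p: "p \<in> points A" for p
    proof -
      obtain x where "x \<in> p" using multigraded_nonempty[OF assms(1) p] .
      then show ?thesis using homog_zero_all_iff[OF assms(1) p _ assms(2)] by simp
    qed
    then show ?thesis by blast
  qed
  then show ?thesis
    using openin_zariski_nonzero[OF assms(2)] by (simp add: closedin_def)
qed

text \<open>A lift can be substituted into homogeneous functions: the preimage of a nonvanishing
  locus is again one, and a fraction of equal degrees becomes a fraction of equal degrees. As the
  lift is global, no charts occur.\<close>

lemma variety_morphism_lift:
  assumes "multigraded A" "multigraded B" "homog_lift A B D \<Phi>"
    and X: "X \<subseteq> points A" and Y: "Y \<subseteq> points B"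
    and lift: "\<And>p. p \<in> X \<Longrightarrow> \<phi> p \<in> Y" "\<And>p x. p \<in> X \<Longrightarrow> x \<in> p \<Longrightarrow> \<Phi> x \<in> \<phi> p"
  shows "variety_morphism A X B Y \<phi>"
proof -
  have pre: "{p \<in> X. \<phi> p \<in> {q \<in> points B. \<forall>y\<in>q. F y \<noteq> 0}} =
      X \<inter> {p \<in> points A. \<forall>x\<in>p. F (\<Phi> x) \<noteq> 0}" if F: "homog B d F" for d F
  proof -
    have "(\<forall>y\<in>\<phi> p. F y \<noteq> 0) \<longleftrightarrow> (\<forall>x\<in>p. F (\<Phi> x) \<noteq> 0)" if p: "p \<in> X" for p
    proof -
      obtain x where x: "x \<in> p"
        using multigraded_nonempty[OF assms(1)] p X by blast
      have "\<phi> p \<in> points B" "p \<in> points A" using lift(1) p X Y by auto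
      then show ?thesis
        using homog_zero_all_iff(2)[OF assms(2) _ lift(2)[OF p x] F]
          homog_zero_all_iff(2)[OF assms(1) _ x homog_comp_lift[OF assms(3) F]] by simp
    qed
    then show ?thesis using lift(1) X Y by auto
  qed
  have "continuous_map (subtopology (zariski A) X)
      (topology_generated_by {{q \<in> points B. \<forall>y\<in>q. F y \<noteq> 0} | d F. homog B d F}) \<phi>"
  proof (rule continuous_on_generated_topo)
    fix U assume "U \<in> {{q \<in> points B. \<forall>y\<in>q. F y \<noteq> 0} | d F. homog B d F}"
    then obtain d F where F: "homog B d F" and U: "U = {q \<in> points B. \<forall>y\<in>q. F y \<noteq> 0}"
      by blast
    have "\<phi> -` U \<inter> topspace (subtopology (zariski A) X) = X \<inter> {p \<in> points A. \<forall>x\<in>p. F (\<Phi> x) \<noteq> 0}"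
      using pre[OF F] X unfolding U by auto
    then show "openin (subtopology (zariski A) X)
        (\<phi> -` U \<inter> topspace (subtopology (zariski A) X))"
      using openin_zariski_nonzero[OF homog_comp_lift[OF assms(3) F]]
      unfolding openin_subtopology by (auto simp: Int_commute)
  next
    show "\<phi> ` topspace (subtopology (zariski A) X)
        \<subseteq> \<Union> {{q \<in> points B. \<forall>y\<in>q. F y \<noteq> 0} | d F. homog B d F}"
      unfolding nonzero_loci_cover using lift(1) Y by auto
  qed
  then have cont: "continuous_map (subtopology (zariski A) X) (subtopology (zariski B) Y) \<phi>"
    using lift(1) by (auto simp: continuous_map_in_subtopology zariski_def[of B])
  have "regular_on A {p \<in> X. \<phi> p \<in> V} (f \<circ> \<phi>)"
    if V: "openin (subtopology (zariski B) Y) V" and f: "regular_on B V f" for V f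
    unfolding regular_on_def
  proof
    fix p assume "p \<in> {p \<in> X. \<phi> p \<in> V}"
    then have p: "p \<in> X" "\<phi> p \<in> V" by auto
    then obtain N d F G where N: "openin (subtopology (zariski B) V) N" "\<phi> p \<in> N"
      and FG: "homog B d F" "homog B d G"
      and eq: "\<And>q y. q \<in> N \<Longrightarrow> y \<in> q \<Longrightarrow> G y \<noteq> 0 \<and> f q = F y / G y"
      using f unfolding regular_on_def by metis
    have NV: "N \<subseteq> V" using openin_imp_subset[OF N(1)] .
    have VY: "V \<subseteq> Y" using openin_imp_subset[OF V] .
    \<comment> \<open>Continuity concerns open subsets of \<open>Y\<close>; since \<open>V\<close>
      is open in \<open>Y\<close>, so is \<open>N\<close>. Its preimage is afterwards viewed inside
      the preimage of \<open>V\<close>.\<close>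
    have "openin (subtopology (subtopology (zariski B) Y) V) N"
      using N(1) VY by (simp add: subtopology_subtopology inf.absorb2)
    then have "openin (subtopology (zariski B) Y) N"
      using V openin_trans_full by blast
    then have "openin (subtopology (zariski A) X) {x \<in> topspace (subtopology (zariski A) X). \<phi> x \<in> N}"
      using cont by (simp add: continuous_map_def)
    moreover have "{x \<in> topspace (subtopology (zariski A) X). \<phi> x \<in> N} = {x \<in> X. \<phi> x \<in> N}"
      using X by auto
    ultimately have "openin (subtopology (zariski A) X) {x \<in> X. \<phi> x \<in> N}" by simp
    then obtain T where "openin (zariski A) T" "{x \<in> X. \<phi> x \<in> N} = T \<inter> X"
      unfolding openin_subtopology by blast
    moreover from this(2) have "{x \<in> X. \<phi> x \<in> N} = T \<inter> {p \<in> X. \<phi> p \<in> V}"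
      using NV by blast
    ultimately have "openin (subtopology (zariski A) {p \<in> X. \<phi> p \<in> V}) {x \<in> X. \<phi> x \<in> N}"
      unfolding openin_subtopology by blast
    moreover have "p \<in> {x \<in> X. \<phi> x \<in> N}" using p N by auto
    moreover have "\<forall>q\<in>{x \<in> X. \<phi> x \<in> N}. \<forall>x\<in>q. G (\<Phi> x) \<noteq> 0 \<and> (f \<circ> \<phi>) q = F (\<Phi> x) / G (\<Phi> x)"
      using eq lift(2) by auto
    ultimately show "\<exists>N d F G. openin (subtopology (zariski A) {p \<in> X. \<phi> p \<in> V}) N \<and> p \<in> N \<and>
        homog A d F \<and> homog A d G \<and> (\<forall>q\<in>N. \<forall>x\<in>q. G x \<noteq> 0 \<and> (f \<circ> \<phi>) q = F x / G x)"
      using homog_comp_lift[OF assms(3) FG(1)] homog_comp_lift[OF assms(3) FG(2)] by blast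
  qed
  with cont show ?thesis unfolding variety_morphism_def by blast
qed

section \<open>Projective spaces\<close>

lemma linear_functionals_iff:
  assumes "vector_space s"
  shows "l \<in> linear_functionals s \<longleftrightarrow>
    (\<forall>x y. l (x + y) = l x + l y) \<and> (\<forall>c x. l (s c x) = c * l x)"
  using assms vector_space_over_itself.vector_space_axioms[where ?'a = complex]
  by (simp add: linear_functionals_def Vector_Spaces.linear_iff)

lemma proj_class_eqI:
  assumes "vector_space s" "x = s c y" "c \<noteq> 0"
  shows "proj_class s x = proj_class s y"
proof -
  interpret vector_space s by fact
  have "s d y = s (d / c) x" for d using assms by simp
  moreover have "s d x = s (d * c) y" for d using assms by simp
  ultimately show ?thesis
    using \<open>c \<noteq> 0\<close> unfolding proj_class_def by (metis (no_types, lifting) divide_eq_0_iff mult_eq_0_iff)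
qed

lemma proj_class_self: "vector_space s \<Longrightarrow> x \<in> proj_class s x"
  using vector_space.vector_space_assms(4)[of s x]
  unfolding proj_class_def by (auto intro!: exI[of _ 1])

lemma proj_class_memD: "vector_space s \<Longrightarrow> x \<in> proj_class s y \<Longrightarrow> proj_class s x = proj_class s y"
  using proj_class_eqI unfolding proj_class_def by blast

lemma coord_projective_space:
  "coord (projective_space s W) d = (if d = 1 then linear_functionals s else {})"
  by (simp add: projective_space_def)

lemma points_projective_space: "points (projective_space s W) = proj_class s ` (W - {0})"
  by (simp add: projective_space_def)

lemma multigraded_projective_space:
  assumes "vector_space s"
  shows "multigraded (projective_space s W)"
proof -
  have "p = q"
    if pq: "p \<in> points (projective_space s W)" "q \<in> points (projective_space s W)" "p \<inter> q \<noteq> {}"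
    for p q
  proof -
    obtain x y z where "p = proj_class s x" "q = proj_class s y" "z \<in> p" "z \<in> q"
      using pq unfolding points_projective_space by blast
    then show ?thesis using proj_class_memD[OF assms] by metis
  qed
  moreover have "\<exists>h. graded_rescaling (projective_space s W) x y h"
    if "p \<in> points (projective_space s W)" "x \<in> p" "y \<in> p" for p x y
  proof -
    from that(1) obtain w where "p = proj_class s w" unfolding points_projective_space by blast
    then have "y \<in> proj_class s x" using proj_class_memD[OF assms] that by metis
    then obtain c where "c \<noteq> 0" "y = s c x" unfolding proj_class_def by blast
    then show ?thesis
      by (intro exI[of _ "\<lambda>d. c ^ d"])
        (auto simp: graded_rescaling_def power_add coord_projective_space linear_functionals_iff[OF assms])
  qed
  moreover have "p \<noteq> {}" if "p \<in> points (projective_space s W)" for p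
    using that proj_class_self[OF assms] unfolding points_projective_space by blast
  ultimately show ?thesis unfolding multigraded_def by simp
qed

lemma multigraded_biprojective:
  assumes A: "multigraded A" and B: "multigraded B"
  shows "multigraded (biprojective A B)"
proof -
  let ?AB = "biprojective A B"
  have pts: "\<exists>p\<in>points A. \<exists>q\<in>points B. r = p \<times> q" if "r \<in> points ?AB" for r
    using that unfolding biprojective_def point_prod_def by auto
  have "r = r'" if rr: "r \<in> points ?AB" "r' \<in> points ?AB" "r \<inter> r' \<noteq> {}" for r r'
  proof -
    obtain p q p' q' where pq: "p \<in> points A" "q \<in> points B" "p' \<in> points A" "q' \<in> points B"
      and r: "r = p \<times> q" "r' = p' \<times> q'"
      using pts rr(1,2) by metis
    then have "p \<inter> p' \<noteq> {}" "q \<inter> q' \<noteq> {}" using \<open>r \<inter> r' \<noteq> {}\<close> by auto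
    then have "p = p'" "q = q'" using multigraded_eq[OF A] multigraded_eq[OF B] pq by simp_all
    with r show ?thesis by simp
  qed
  moreover have "\<exists>h. graded_rescaling ?AB x y h"
    if r: "r \<in> points ?AB" and xy: "x \<in> r" "y \<in> r" for r x y
  proof -
    obtain p q where pq: "p \<in> points A" "q \<in> points B" "r = p \<times> q" using pts[OF r] by blast
    then have mem: "fst x \<in> p" "fst y \<in> p" "snd x \<in> q" "snd y \<in> q" using xy by auto
    obtain h where h: "graded_rescaling A (fst x) (fst y) h"
      using multigraded_rescaling[OF A pq(1) mem(1,2)] .
    obtain k where k: "graded_rescaling B (snd x) (snd y) k"
      using multigraded_rescaling[OF B pq(2) mem(3,4)] .
    have "graded_rescaling ?AB x y (\<lambda>d. h (fst d) * k (snd d))"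
      using h k unfolding graded_rescaling_def
      by (auto simp: biprojective_def zero_prod_def)
    then show ?thesis by blast
  qed
  moreover have "r \<noteq> {}" if "r \<in> points ?AB" for r
    using pts[OF that] A B by (auto simp: multigraded_def)
  ultimately show ?thesis unfolding multigraded_def by simp
qed

section \<open>The space of forms and a criterion for isomorphism with a family of forms\<close>

lemma vector_space_scale_form: "vector_space scale_form"
  by unfold_locales (auto simp: scale_form_def fun_eq_iff algebra_simps)

text \<open>Values of a form count as homogeneous coordinates, so coefficients and proportionality
  of forms can be expressed by homogeneous functions.\<close>

lemma eval_coord: "(\<lambda>\<eta>. \<eta> z v) \<in> coord form_space 1"
  by (simp add: coord_projective_space linear_functionals_iff[OF vector_space_scale_form]
      scale_form_def)

text \<open>The image is locally closed because it consists of the \<open>\<eta>\<close> with \<open>\<kappa> \<eta> \<noteq> 0\<close> that are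
  proportional to \<open>\<Phi> (\<Phi>' \<eta>)\<close>, and proportionality is the vanishing of the
  \<open>2 \<times> 2\<close> minors of the pairs of values of \<open>\<eta>\<close> and \<open>\<Phi> (\<Phi>' \<eta>)\<close>.\<close>

lemma isomorphic_varieties_lifts:
  fixes B :: "('w, 'e::comm_monoid_add) multiproj" and \<Phi> :: "'w \<Rightarrow> one_form"
  assumes B: "multigraded B" and Y: "locally_closed B Y"
    and lift: "homog_lift B form_space D \<Phi>" and lift': "homog_lift form_space B D' \<Phi>'"
    and kappa: "homog form_space k \<kappa>"
    and twisted: "\<And>q y. q \<in> Y \<Longrightarrow> y \<in> q \<Longrightarrow> \<Phi> y \<in> twisted_forms - {0}"
    and kappa_nz: "\<And>q y. q \<in> Y \<Longrightarrow> y \<in> q \<Longrightarrow> \<kappa> (\<Phi> y) \<noteq> 0"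
    and retract: "\<And>q y c. q \<in> Y \<Longrightarrow> y \<in> q \<Longrightarrow> c \<noteq> 0 \<Longrightarrow> \<Phi>' (scale_form c (\<Phi> y)) \<in> q"
    and into: "\<And>\<eta>. \<kappa> \<eta> \<noteq> 0 \<Longrightarrow> \<exists>q\<in>Y. \<Phi>' \<eta> \<in> q"
  shows "isomorphic_varieties form_space {proj_class scale_form (\<Phi> y) | y q. q \<in> Y \<and> y \<in> q} B Y"
    (is "isomorphic_varieties _ ?X _ _")
proof -
  note vs = vector_space_scale_form
  have A: "multigraded form_space" by (rule multigraded_projective_space[OF vs])
  have YB: "Y \<subseteq> points B"
    using Y openin_subset unfolding locally_closed_def by fastforce
  have evPhi: "homog B (D 1) (\<lambda>y. \<Phi> y z v)" for z v
    using homog_comp_lift[OF lift homog_coord[OF eval_coord]] .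
  \<comment> \<open>Changing the coordinates of a point multiplies every value of the form by the
    one factor attached to degree \<open>D 1\<close>, so the class of \<open>\<Phi> y\<close>
    depends only on the point.\<close>
  have class_Phi: "\<exists>c. c \<noteq> 0 \<and> \<Phi> y' = scale_form c (\<Phi> y)" if q: "q \<in> Y" and y: "y \<in> q" "y' \<in> q" for q y y'
  proof -
    have "q \<in> points B" using q YB by blast
    then obtain h where h: "graded_rescaling B y y' h"
      using multigraded_rescaling[OF B _ y] by blast
    then have "h (D 1) \<noteq> 0" "\<Phi> y' = scale_form (h (D 1)) (\<Phi> y)"
      using graded_rescaling_homog[OF h evPhi]
      by (auto simp: scale_form_def fun_eq_iff graded_rescaling_def)
    then show ?thesis by blast
  qed
  define \<psi> where "\<psi> q = proj_class scale_form (\<Phi> (SOME y. y \<in> q))" for q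
  have psi: "\<psi> q = proj_class scale_form (\<Phi> y)" if "q \<in> Y" "y \<in> q" for q y
    using class_Phi[OF that(1,2)] someI[of "\<lambda>y. y \<in> q", OF that(2)] proj_class_eqI[OF vs]
      that unfolding \<psi>_def by blast
  have ne: "\<exists>y. y \<in> q" if "q \<in> Y" for q
    using multigraded_nonempty[OF B] that YB by blast
  have X: "?X = \<psi> ` Y"
    using psi ne by (fastforce simp: image_iff)
  have XA: "?X \<subseteq> points form_space"
    using twisted by (auto simp: points_projective_space)
  have lift_mem: "\<Phi>' \<eta> \<in> q" if "q \<in> Y" "\<eta> \<in> \<psi> q" for q \<eta>
  proof -
    obtain y where y: "y \<in> q" using ne \<open>q \<in> Y\<close> by blast
    have "\<eta> \<in> proj_class scale_form (\<Phi> y)" using that psi[OF _ y] by simp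
    then obtain c where "c \<noteq> 0" "\<eta> = scale_form c (\<Phi> y)"
      unfolding proj_class_def by blast
    then show ?thesis using retract[OF \<open>q \<in> Y\<close> y] by simp
  qed
  \<comment> \<open>\<open>\<Phi>'\<close> sends a form in the common class into both
    \<open>q\<close> and \<open>q'\<close>, and distinct points are disjoint.\<close>
  have inj: "inj_on \<psi> Y"
  proof (rule inj_onI)
    fix q q' assume q: "q \<in> Y" "q' \<in> Y" "\<psi> q = \<psi> q'"
    obtain y where "y \<in> q" using ne q by blast
    then have "\<Phi> y \<in> \<psi> q" using psi[OF q(1)] proj_class_self[OF vs] by simp
    then have "q \<inter> q' \<noteq> {}" using lift_mem q by blast
    moreover have "q \<in> points B" "q' \<in> points B" using q YB by auto
    ultimately show "q = q'" using multigraded_eq[OF B] by blast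
  qed
  define \<phi> where "\<phi> = inv_into Y \<psi>"
  have phi_psi: "\<phi> (\<psi> q) = q" if "q \<in> Y" for q
    unfolding \<phi>_def using inv_into_f_f[OF inj that] .
  have "variety_morphism form_space ?X B Y \<phi>"
  proof (rule variety_morphism_lift[OF A B lift' XA YB])
    fix p assume p: "p \<in> ?X"
    then obtain q where q: "q \<in> Y" "p = \<psi> q" unfolding X by blast
    then show "\<phi> p \<in> Y" using phi_psi by simp
    show "\<Phi>' x \<in> \<phi> p" if "x \<in> p" for x
      using lift_mem q that phi_psi by simp
  qed
  moreover have "variety_morphism B Y form_space ?X \<psi>"
  proof (rule variety_morphism_lift[OF B A lift YB XA])
    show "\<psi> q \<in> ?X" if "q \<in> Y" for q unfolding X using that by blast
    show "\<Phi> y \<in> \<psi> q" if "q \<in> Y" "y \<in> q" for q y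
      using psi[OF that] proj_class_self[OF vs] by simp
  qed
  moreover have "locally_closed form_space ?X"
  proof -
    let ?U = "{p \<in> points form_space. \<forall>\<eta>\<in>p. \<kappa> \<eta> \<noteq> 0}"
    let ?M = "\<lambda>(z, v, z', v') \<eta>. \<Phi> (\<Phi>' \<eta>) z v * \<eta> z' v' - \<Phi> (\<Phi>' \<eta>) z' v' * \<eta> z v"
    let ?C = "\<lambda>i. {p \<in> points form_space. \<forall>\<eta>\<in>p. ?M i \<eta> = 0}"
    have "homog form_space (D' (D 1) + 1) (?M i)" for i
      by (cases i)
        (auto intro!: homog_diff homog_times homog_coord[OF eval_coord] homog_comp_lift[OF lift' evPhi]
          simp del: One_nat_def)
    then have "closedin (zariski form_space) (?C i)" for i
      using closedin_zariski_zero[OF A] by blast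
    then have "closedin (zariski form_space) (\<Inter> (range ?C))"
      by (intro closedin_Inter) auto
    moreover have "openin (zariski form_space) ?U"
      by (rule openin_zariski_nonzero[OF kappa])
    moreover have "?X = ?U \<inter> \<Inter> (range ?C)"
    proof (intro equalityI subsetI)
      fix p assume p: "p \<in> ?X"
      then obtain q where q: "q \<in> Y" "p = \<psi> q" unfolding X by blast
      obtain y where y: "y \<in> q" using ne q by blast
      have pcl: "p = proj_class scale_form (\<Phi> y)" using psi q y by simp
      have pA: "p \<in> points form_space" using p XA by blast
      have "\<Phi> y \<in> p" unfolding pcl by (rule proj_class_self[OF vs])
      then have "p \<in> ?U"
        using pA homog_zero_all_iff(2)[OF A pA _ kappa] kappa_nz[OF q(1) y] by blast
      \<comment> \<open>\<open>\<Phi>' \<eta>\<close> lies in \<open>q\<close> again, so both rows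
        of each minor are multiples of the single form \<open>\<Phi> y\<close>.\<close>
      moreover have "?M i \<eta> = 0" if eta: "\<eta> \<in> p" for i \<eta>
      proof -
        obtain c where "\<eta> = scale_form c (\<Phi> y)" using eta unfolding pcl proj_class_def by blast
        moreover obtain d where "\<Phi> (\<Phi>' \<eta>) = scale_form d (\<Phi> y)"
          using class_Phi[OF q(1) y] lift_mem q eta by blast
        ultimately show ?thesis by (simp add: scale_form_def split: prod.split)
      qed
      ultimately show "p \<in> ?U \<inter> \<Inter> (range ?C)" using pA by blast
    next
      fix p assume p: "p \<in> ?U \<inter> \<Inter> (range ?C)"
      then obtain \<eta> where eta: "\<eta> \<noteq> 0" "p = proj_class scale_form \<eta>"
        unfolding points_projective_space by blast
      then have etap: "\<eta> \<in> p" using proj_class_self[OF vs] by simp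
      then have "\<kappa> \<eta> \<noteq> 0" using p by blast
      then obtain q where q: "q \<in> Y" "\<Phi>' \<eta> \<in> q" using into by blast
      define \<theta> where "\<theta> = \<Phi> (\<Phi>' \<eta>)"
      have "\<theta> \<noteq> 0" using twisted[OF q] by (simp add: \<theta>_def)
      \<comment> \<open>One nonzero value serves as pivot: the minors containing it already give
        proportionality, and \<open>\<theta> \<noteq> 0\<close> makes the ratio nonzero.\<close>
      obtain z' v' where nz: "\<eta> z' v' \<noteq> 0" using eta(1) by (auto simp: fun_eq_iff)
      have minors: "\<theta> z v * \<eta> z' v' = \<theta> z' v' * \<eta> z v" for z v
      proof -
        have "p \<in> ?C (z, v, z', v')" using p by blast
        then have "?M (z, v, z', v') \<eta> = 0" using etap by blast
        then show ?thesis by (simp add: \<theta>_def)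
      qed
      define c where "c = \<theta> z' v' / \<eta> z' v'"
      have th: "\<theta> = scale_form c \<eta>"
        using minors nz by (auto simp: fun_eq_iff scale_form_def c_def field_simps)
      moreover from this have "c \<noteq> 0"
        using \<open>\<theta> \<noteq> 0\<close> by (auto simp: scale_form_def fun_eq_iff)
      ultimately have "p = proj_class scale_form \<theta>" using proj_class_eqI[OF vs] eta(2) by blast
      then show "p \<in> ?X" using q unfolding \<theta>_def by blast
    qed
    ultimately show ?thesis unfolding locally_closed_def by blast
  qed
  ultimately show ?thesis
    unfolding isomorphic_varieties_def X
    using Y phi_psi by (intro conjI exI[of _ \<phi>] exI[of _ \<psi>]) auto
qed

section \<open>Homogeneous families of forms\<close>

text \<open>A family that is a finite sum of fixed functions with homogeneous coefficients; unlike the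
  homogeneity of all its values this passes through arbitrary linear functionals.\<close>

inductive homog_family ::
  "('v, 'd::comm_monoid_add) multiproj \<Rightarrow> 'd \<Rightarrow> ('v \<Rightarrow> 'a \<Rightarrow> 'b \<Rightarrow> complex) \<Rightarrow> bool" for A where
  single: "homog A d F \<Longrightarrow> homog_family A d (\<lambda>x z v. F x * b z v)"
| add: "homog_family A d \<Phi> \<Longrightarrow> homog_family A d \<Psi> \<Longrightarrow>
    homog_family A d (\<lambda>x z v. \<Phi> x z v + \<Psi> x z v)"

lemma homog_family_single_times:
  assumes "homog_family A e \<Psi>" "homog A d F"
  shows "homog_family A (d + e) (\<lambda>x z v. F x * b z v * \<Psi> x z v)"
  using assms(1)
proof (induction rule: homog_family.induct)
  case (single e G c)
  then show ?case
    using homog_family.single[OF homog_times[OF assms(2)], of e G "\<lambda>z v. b z v * c z v"]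
    by (simp add: ac_simps)
next
  case (add e \<Phi> \<Psi>)
  then show ?case using homog_family.add by (fastforce simp: distrib_left)
qed

lemma homog_family_times:
  assumes "homog_family A d \<Phi>" "homog_family A e \<Psi>"
  shows "homog_family A (d + e) (\<lambda>x z v. \<Phi> x z v * \<Psi> x z v)"
  using assms(1)
proof (induction rule: homog_family.induct)
  case (single d F b)
  then show ?case using homog_family_single_times[OF assms(2)] by blast
next
  case (add d \<Phi> \<Phi>')
  then show ?case using homog_family.add by (fastforce simp: distrib_right)
qed

lemma homog_family_homog_times:
  "homog A d F \<Longrightarrow> homog_family A e \<Psi> \<Longrightarrow> homog_family A (d + e) (\<lambda>x z v. F x * \<Psi> x z v)"
  using homog_family_single_times[of A e \<Psi> d F "\<lambda>_ _. 1"] by simp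

lemma homog_family_cmult:
  "homog_family A d \<Phi> \<Longrightarrow> homog_family A d (\<lambda>x z v. c * \<Phi> x z v)"
  using homog_family_homog_times[OF homog.const] by fastforce

lemma homog_family_diff:
  assumes "homog_family A d \<Phi>" "homog_family A d \<Psi>"
  shows "homog_family A d (\<lambda>x z v. \<Phi> x z v - \<Psi> x z v)"
  using homog_family.add[OF assms(1) homog_family_cmult[OF assms(2), of "-1"]] by simp

text \<open>A fixed function \<open>b\<close> contributes only the constant \<open>l b\<close>,
  however wild the functional \<open>l\<close> is.\<close>

lemma homog_linear_functional_family:
  assumes "homog_family A d \<Phi>" "l \<in> linear_functionals scale_form"
  shows "homog A d (\<lambda>x. l (\<Phi> x))"
  using assms(1)
proof (induction rule: homog_family.induct)
  case (single d F b)
  have "l (\<lambda>z v. F x * b z v) = F x * l b" for x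
    using assms(2) unfolding linear_functionals_iff[OF vector_space_scale_form]
    by (simp flip: scale_form_def)
  then show ?case using single homog_cmult[of A d F "l b"] by (simp add: mult.commute)
next
  case (add d \<Phi> \<Psi>)
  have "l (\<lambda>z v. \<Phi> x z v + \<Psi> x z v) = l (\<Phi> x) + l (\<Psi> x)" for x
    using assms(2) unfolding linear_functionals_iff[OF vector_space_scale_form]
    by (simp flip: plus_fun_apply) (simp add: plus_fun_def)
  then show ?case using add homog.add by simp
qed

lemma homog_lift_family:
  assumes "homog_family A (D 1) \<Phi>" "D 0 = 0" "\<And>d e. D (d + e) = D d + D e"
  shows "homog_lift A form_space D \<Phi>"
  using assms homog_linear_functional_family
  by (auto simp: homog_lift_def coord_projective_space)

section \<open>Twisted cubic forms\<close>

text \<open>The degree condition is separated from contraction with the radial vector field. The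
  latter reads \<eta> z z = 0, which pullback by a linear map visibly preserves.\<close>

definition cubic_form :: "one_form \<Rightarrow> bool" where
  "cubic_form \<eta> \<longleftrightarrow> (\<exists>A. (\<forall>i. homog (Proj :: (complex ^ 4, nat) multiproj) 3 (A i)) \<and>
     \<eta> = (\<lambda>z v. \<Sum>i\<in>UNIV. A i z * v $ i))"

lemma twisted_forms_iff: "\<eta> \<in> twisted_forms \<longleftrightarrow> cubic_form \<eta> \<and> (\<forall>z. \<eta> z z = 0)"
  unfolding twisted_forms_def cubic_form_def dz_def by (auto simp: mult.commute)

lemma cubic_form_add:
  assumes "cubic_form \<eta>" "cubic_form \<theta>"
  shows "cubic_form (\<lambda>z v. \<eta> z v + \<theta> z v)"
proof -
  obtain A B where "\<forall>i. homog Proj 3 (A i)" "\<eta> = (\<lambda>z v. \<Sum>i\<in>UNIV. A i z * v $ i)"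
    "\<forall>i. homog Proj 3 (B i)" "\<theta> = (\<lambda>z v. \<Sum>i\<in>UNIV. B i z * v $ i)"
    using assms unfolding cubic_form_def by auto
  then show ?thesis
    unfolding cubic_form_def
    by (intro exI[of _ "\<lambda>i z. A i z + B i z"])
      (auto intro!: homog.add simp: sum.distrib distrib_right)
qed

lemma cubic_form_cmult:
  assumes "cubic_form \<eta>"
  shows "cubic_form (\<lambda>z v. c * \<eta> z v)"
proof -
  obtain A where "\<forall>i. homog Proj 3 (A i)" "\<eta> = (\<lambda>z v. \<Sum>i\<in>UNIV. A i z * v $ i)"
    using assms unfolding cubic_form_def by auto
  then show ?thesis
    unfolding cubic_form_def
    by (intro exI[of _ "\<lambda>i z. c * A i z"])
      (auto intro!: homog_cmult simp: sum_distrib_left mult.assoc)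
qed

lemma vector_space_vec: "vector_space ((*s) :: complex \<Rightarrow> complex ^ 'n \<Rightarrow> complex ^ 'n)"
  by (rule vec.vector_space_axioms)

lemma nth_linear_functional: "(\<lambda>x :: complex ^ 'n. x $ i) \<in> linear_functionals (*s)"
  by (simp add: linear_functionals_iff[OF vector_space_vec])

lemma homog_nth: "homog (Proj :: (complex ^ 'n, nat) multiproj) 1 (\<lambda>x. x $ i)"
  by (rule homog_coord) (simp add: coord_projective_space nth_linear_functional)

lemma cubic_form_monomial: "cubic_form (\<lambda>z v. z $ a * (z $ b * (z $ c * v $ d)))"
proof -
  have "homog Proj (1 + (1 + 1)) (\<lambda>z :: complex ^ 4. z $ a * (z $ b * z $ c))"
    by (intro homog_times homog_nth)
  then have cubic: "homog Proj 3 (\<lambda>z :: complex ^ 4. z $ a * (z $ b * z $ c))"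
    by (simp add: numeral_3_eq_3)
  then have "homog Proj 3 (\<lambda>z :: complex ^ 4. if i = d then z $ a * (z $ b * z $ c) else 0)" for i
    using homog_cmult[OF cubic, of 0] by (cases "i = d") simp_all
  then show ?thesis
    unfolding cubic_form_def
    by (intro exI[of _ "\<lambda>i z. if i = d then z $ a * (z $ b * z $ c) else 0"])
      (simp add: if_distrib[of "\<lambda>x. x * _"] sum.delta mult.assoc cong: if_cong)
qed

text \<open>Substituting g z keeps the degree, and the differentials mix by the columns of g: the
  new coefficient of index j is the sum over i of A_i(g z) g_ij.\<close>

lemma cubic_form_pullback:
  assumes "cubic_form \<eta>"
  shows "cubic_form (pullback g \<eta>)"
proof -
  obtain A where A: "\<And>i. homog Proj 3 (A i)" and eta: "\<eta> = (\<lambda>z v. \<Sum>i\<in>UNIV. A i z * v $ i)"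
    using assms unfolding cubic_form_def by auto
  have "homog_lift Proj Proj id ((*v) g)"
    by (auto simp: homog_lift_def coord_projective_space linear_functionals_iff[OF vector_space_vec]
        vec.add vec.scale intro!: homog_coord)
  from homog_comp_lift[OF this A] have gA: "homog Proj 3 (\<lambda>z. A i (g *v z))" for i by simp
  have "homog Proj 3 (\<lambda>z. \<Sum>i\<in>I. A i (g *v z) * g $ i $ j)" if "finite I" for I j
    using that
  proof (induction I rule: finite_induct)
    case empty
    show ?case using homog_cmult[OF gA, of 0] by simp
  next
    case (insert i I)
    then show ?case
      using homog.add[OF homog_cmult[OF gA[of i], of "g $ i $ j"]] by (simp add: mult.commute)
  qed
  then have "\<forall>j. homog Proj 3 (\<lambda>z. \<Sum>i\<in>UNIV. A i (g *v z) * g $ i $ j)" by simp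
  moreover have "pullback g \<eta> = (\<lambda>z v. \<Sum>j\<in>UNIV. (\<Sum>i\<in>UNIV. A i (g *v z) * g $ i $ j) * v $ j)"
  proof (intro ext)
    fix z v
    have "pullback g \<eta> z v = (\<Sum>i\<in>UNIV. \<Sum>j\<in>UNIV. A i (g *v z) * g $ i $ j * v $ j)"
      by (simp add: pullback_def eta matrix_vector_mult_def sum_distrib_left mult.assoc)
    also have "\<dots> = (\<Sum>j\<in>UNIV. \<Sum>i\<in>UNIV. A i (g *v z) * g $ i $ j * v $ j)"
      by (rule sum.swap)
    finally show "pullback g \<eta> z v = (\<Sum>j\<in>UNIV. (\<Sum>i\<in>UNIV. A i (g *v z) * g $ i $ j) * v $ j)"
      by (simp add: sum_distrib_right)
  qed
  ultimately show ?thesis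
    unfolding cubic_form_def
    by (intro exI[of _ "\<lambda>j z. \<Sum>i\<in>UNIV. A i (g *v z) * g $ i $ j"] conjI)
qed

lemma twisted_forms_pullback: "\<eta> \<in> twisted_forms \<Longrightarrow> pullback g \<eta> \<in> twisted_forms"
  by (auto simp: twisted_forms_iff cubic_form_pullback) (simp add: pullback_def)

lemma twisted_forms_add: "\<eta> \<in> twisted_forms \<Longrightarrow> \<theta> \<in> twisted_forms \<Longrightarrow> \<eta> + \<theta> \<in> twisted_forms"
  by (auto simp: twisted_forms_iff plus_fun_def intro: cubic_form_add)

lemma twisted_forms_scale: "\<eta> \<in> twisted_forms \<Longrightarrow> scale_form c \<eta> \<in> twisted_forms"
  by (auto simp: twisted_forms_iff scale_form_def intro: cubic_form_cmult)

lemma twisted_omega: "\<omega>\<^sub>1 \<in> twisted_forms" "\<omega>\<^sub>2 \<in> twisted_forms" "\<omega>\<^sub>3 \<in> twisted_forms"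
proof -
  let ?m = "\<lambda>c i j k l (z :: complex ^ 4) (v :: complex ^ 4). c * (z $ i * (z $ j * (z $ k * v $ l)))"
  have eq1: "\<omega>\<^sub>1 = (\<lambda>z v. ?m 1 2 3 2 4 z v + (?m (-1) 2 3 4 2 z v + (?m (-2) 2 4 2 3 z v + ?m 2 2 4 3 2 z v)))"
    by (intro ext) (simp add: \<omega>\<^sub>1_def vf_def dz_def algebra_simps)
  have "cubic_form \<omega>\<^sub>1"
    unfolding eq1 by (intro cubic_form_add cubic_form_cmult cubic_form_monomial)
  then show "\<omega>\<^sub>1 \<in> twisted_forms"
    by (simp add: twisted_forms_iff \<omega>\<^sub>1_def vf_def dz_def algebra_simps)
  have eq2: "\<omega>\<^sub>2 = (\<lambda>z v. ?m 3 3 4 1 3 z v + (?m (-3) 3 4 3 1 z v + (?m (-2) 3 3 1 4 z v + ?m 2 3 3 4 1 z v)))"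
    by (intro ext) (simp add: \<omega>\<^sub>2_def vf_def dz_def algebra_simps)
  have "cubic_form \<omega>\<^sub>2"
    unfolding eq2 by (intro cubic_form_add cubic_form_cmult cubic_form_monomial)
  then show "\<omega>\<^sub>2 \<in> twisted_forms"
    by (simp add: twisted_forms_iff \<omega>\<^sub>2_def vf_def dz_def algebra_simps)
  have eq3: "\<omega>\<^sub>3 = (\<lambda>z v. ?m 1 4 2 1 4 z v + (?m (-1) 4 2 4 1 z v + (?m (-3) 4 4 1 2 z v + ?m 3 4 4 2 1 z v)))"
    by (intro ext) (simp add: \<omega>\<^sub>3_def vf_def dz_def algebra_simps)
  have "cubic_form \<omega>\<^sub>3"
    unfolding eq3 by (intro cubic_form_add cubic_form_cmult cubic_form_monomial)
  then show "\<omega>\<^sub>3 \<in> twisted_forms"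
    by (simp add: twisted_forms_iff \<omega>\<^sub>3_def vf_def dz_def algebra_simps)
qed

section \<open>Pullback by matrices that depend on parameters\<close>

lemma pullback_mult: "pullback (g ** h) \<eta> = pullback h (pullback g \<eta>)"
  by (simp add: pullback_def matrix_vector_mul_assoc)

lemma homog_family_mult_vec:
  fixes M :: "'v \<Rightarrow> complex ^ 4 ^ 4"
  assumes "\<And>i j. homog A d (\<lambda>x. M x $ i $ j)"
  shows "homog_family A d (\<lambda>x z v. (M x *v z) $ i)" "homog_family A d (\<lambda>x z v. (M x *v v) $ i)"
  unfolding matrix_vector_mult_def sum_4 vec_lambda_beta
  by (intro homog_family.add homog_family.single assms)+

text \<open>Each term has three factors \<open>z\<close> and one factor \<open>v\<close>, and each
  of them brings in one matrix entry of degree \<open>d\<close>.\<close>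

lemma homog_family_pullback_omega:
  fixes M :: "'v \<Rightarrow> complex ^ 4 ^ 4"
  assumes "\<And>i j. homog A d (\<lambda>x. M x $ i $ j)" "\<omega> \<in> {\<omega>\<^sub>1, \<omega>\<^sub>2, \<omega>\<^sub>3}"
  shows "homog_family A (d + (d + (d + d))) (\<lambda>x. pullback (M x) \<omega>)"
proof -
  note family_intros = homog_family_diff homog_family_cmult homog_family_times
    homog_family_mult_vec[OF assms(1)]
  have "homog_family A (d + (d + (d + d))) (\<lambda>x. pullback (M x) \<omega>\<^sub>1)"
    unfolding pullback_def \<omega>\<^sub>1_def vf_def dz_def mult.assoc by (intro family_intros)
  moreover have "homog_family A (d + (d + (d + d))) (\<lambda>x. pullback (M x) \<omega>\<^sub>2)"
    unfolding pullback_def \<omega>\<^sub>2_def vf_def dz_def mult.assoc by (intro family_intros)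
  moreover have "homog_family A (d + (d + (d + d))) (\<lambda>x. pullback (M x) \<omega>\<^sub>3)"
    unfolding pullback_def \<omega>\<^sub>3_def vf_def dz_def mult.assoc by (intro family_intros)
  ultimately show ?thesis using assms(2) by auto
qed

section \<open>Upper triangular matrices\<close>

lemma vector_4 [simp]:
  "(vector [a, b, c, d] :: 'a::zero ^ 4) $ 1 = a"
  "(vector [a, b, c, d] :: 'a::zero ^ 4) $ 2 = b"
  "(vector [a, b, c, d] :: 'a::zero ^ 4) $ 3 = c"
  "(vector [a, b, c, d] :: 'a::zero ^ 4) $ 4 = d"
  unfolding vector_def by simp_all

lemma vector_6 [simp]:
  "(vector [a, b, c, d, e, f] :: 'a::zero ^ 6) $ 1 = a"
  "(vector [a, b, c, d, e, f] :: 'a::zero ^ 6) $ 2 = b"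
  "(vector [a, b, c, d, e, f] :: 'a::zero ^ 6) $ 3 = c"
  "(vector [a, b, c, d, e, f] :: 'a::zero ^ 6) $ 4 = d"
  "(vector [a, b, c, d, e, f] :: 'a::zero ^ 6) $ 5 = e"
  "(vector [a, b, c, d, e, f] :: 'a::zero ^ 6) $ 6 = f"
  unfolding vector_def by simp_all

lemma exhaust_6:
  fixes x :: 6
  shows "x = 1 \<or> x = 2 \<or> x = 3 \<or> x = 4 \<or> x = 5 \<or> x = 6"
proof (induct x)
  case (of_int z)
  then have "z = 0 \<or> z = 1 \<or> z = 2 \<or> z = 3 \<or> z = 4 \<or> z = 5" by fastforce
  then show ?case by auto
qed

lemma forall_6: "(\<forall>i::6. Q i) \<longleftrightarrow> Q 1 \<and> Q 2 \<and> Q 3 \<and> Q 4 \<and> Q 5 \<and> Q 6"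
  by (metis exhaust_6)

definition upper :: "complex \<Rightarrow> complex \<Rightarrow> complex \<Rightarrow> complex \<Rightarrow> complex \<Rightarrow> complex \<Rightarrow> complex \<Rightarrow>
    complex \<Rightarrow> complex \<Rightarrow> complex \<Rightarrow> complex ^ 4 ^ 4" where
  "upper a b c d k m n q s p =
     vector [vector [a, k, m, n], vector [0, b, q, s], vector [0, 0, c, p], vector [0, 0, 0, d]]"

lemma upper_mult_vec:
  "(upper a b c d k m n q s p *v z) $ 1 = a * z $ 1 + k * z $ 2 + m * z $ 3 + n * z $ 4"
  "(upper a b c d k m n q s p *v z) $ 2 = b * z $ 2 + q * z $ 3 + s * z $ 4"
  "(upper a b c d k m n q s p *v z) $ 3 = c * z $ 3 + p * z $ 4"
  "(upper a b c d k m n q s p *v z) $ 4 = d * z $ 4"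
  by (simp_all add: upper_def matrix_vector_mult_def sum_4)

lemma upper_mult:
  "upper a b c d k m n q s p ** upper a' b' c' d' k' m' n' q' s' p' =
   upper (a * a') (b * b') (c * c') (d * d')
     (a * k' + k * b') (a * m' + k * q' + m * c') (a * n' + k * s' + m * p' + n * d')
     (b * q' + q * c') (b * s' + q * p' + s * d') (c * p' + p * d')"
  by (simp add: upper_def matrix_matrix_mult_def sum_4 vec_eq_iff forall_4)

lemma upper_mat_1: "upper 1 1 1 1 0 0 0 0 0 0 = mat 1"
  by (simp add: upper_def mat_def vec_eq_iff forall_4)

text \<open>In the order of the index type 4 = 0 comes first, so these matrices are not triangular
  for that order. The sum over permutations is expanded instead.\<close>

lemma det_upper: "det (upper a b c d k m n q s p) = a * b * c * d"
proof -
  have f1: "finite {2::4, 3, 4}" "1 \<notin> {2::4, 3, 4}"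
    and f2: "finite {3::4, 4}" "2 \<notin> {3::4, 4}"
    and f3: "finite {4::4}" "3 \<notin> {4::4}"
    by auto
  show ?thesis
    unfolding det_def UNIV_4
    unfolding sum_over_permutations_insert[OF f1] sum_over_permutations_insert[OF f2]
      sum_over_permutations_insert[OF f3] permutes_sing
    by (simp add: upper_def sign_swap_id permutation_swap_id sign_compose sign_id swap_id_eq
        permutation_compose)
qed

lemma P_iff: "g \<in> P \<longleftrightarrow> (\<exists>a b c d k m n q s p. g = upper a b c d k m n q s p \<and> a * b * c * d = 1)"
proof
  assume g: "g \<in> P"
  have "g = upper (g$1$1) (g$2$2) (g$3$3) (g$4$4) (g$1$2) (g$1$3) (g$1$4) (g$2$3) (g$2$4) (g$3$4)"
    using g by (simp add: P_def upper_def vec_eq_iff forall_4)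
  moreover from this have "det g = g$1$1 * g$2$2 * g$3$3 * g$4$4"
    using det_upper by metis
  then have "g$1$1 * g$2$2 * g$3$3 * g$4$4 = 1" using g by (simp add: P_def)
  ultimately show "\<exists>a b c d k m n q s p. g = upper a b c d k m n q s p \<and> a * b * c * d = 1"
    by blast
next
  assume "\<exists>a b c d k m n q s p. g = upper a b c d k m n q s p \<and> a * b * c * d = 1"
  then show "g \<in> P" by (auto simp: P_def det_upper) (simp_all add: upper_def)
qed

lemma matrix_inv_eq:
  fixes g h :: "complex ^ 'n ^ 'n"
  assumes "g ** h = mat 1"
  shows "matrix_inv g = h"
proof -
  have hg: "h ** g = mat 1" using assms matrix_left_right_inverse by blast
  have "g ** matrix_inv g = mat 1"
    unfolding matrix_inv_def using assms hg by (rule_tac someI2) auto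
  then have "h ** (g ** matrix_inv g) = h" by simp
  then show ?thesis by (simp add: matrix_mul_assoc hg)
qed

lemma P_inverse:
  assumes "g \<in> P"
  obtains h where "h \<in> P" "g ** h = mat 1"
proof -
  obtain a b c d k m n q s p where g: "g = upper a b c d k m n q s p" and 1: "a * b * c * d = 1"
    using assms unfolding P_iff by blast
  then have nz: "a \<noteq> 0" "b \<noteq> 0" "c \<noteq> 0" "d \<noteq> 0" by auto
  \<comment> \<open>Back substitution, one superdiagonal after the other.\<close>
  define k' q' p' where "k' = - k / (a * b)" "q' = - q / (b * c)" "p' = - p / (c * d)"
  define m' s' where "m' = - (k * q' + m / c) / a" "s' = - (q * p' + s / d) / b"
  define n' where "n' = - (k * s' + m * p' + n / d) / a"
  let ?h = "upper (1 / a) (1 / b) (1 / c) (1 / d) k' m' n' q' s' p'"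
  have "g ** ?h = mat 1"
    unfolding g upper_mult upper_mat_1[symmetric]
    using nz by (simp add: k'_q'_p'_def m'_s'_def n'_def)
  moreover have "1 / a * (1 / b) * (1 / c) * (1 / d) = 1" using 1 by simp
  then have "?h \<in> P" unfolding P_iff by blast
  ultimately show thesis using that by blast
qed

text \<open>Inversion permutes \<open>P\<close>, so the inverse in \<open>act\<close> disappears
  from the orbit.\<close>

lemma P_orbit_pullback: "P_orbit \<eta> = {proj_class scale_form (pullback g \<eta>) | g. g \<in> P}"
proof (intro equalityI subsetI)
  fix x assume "x \<in> P_orbit \<eta>"
  then obtain g where g: "g \<in> P" "x = proj_class scale_form (pullback (matrix_inv g) \<eta>)"
    unfolding P_orbit_def act_def by blast
  obtain h where "h \<in> P" "g ** h = mat 1" using P_inverse[OF g(1)] .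
  then show "x \<in> {proj_class scale_form (pullback g \<eta>) | g. g \<in> P}"
    using matrix_inv_eq g(2) by blast
next
  fix x assume "x \<in> {proj_class scale_form (pullback g \<eta>) | g. g \<in> P}"
  then obtain g where g: "g \<in> P" "x = proj_class scale_form (pullback g \<eta>)" by blast
  obtain h where h: "h \<in> P" "g ** h = mat 1" using P_inverse[OF g(1)] .
  then have "matrix_inv h = g" using matrix_inv_eq matrix_left_right_inverse by blast
  then show "x \<in> P_orbit \<eta>" using h g unfolding P_orbit_def act_def by blast
qed

section \<open>Cones over affine space\<close>

lemma homog_zero: "homog A d F \<Longrightarrow> homog A d (\<lambda>x. 0)"
  using homog_cmult[of A d F 0] by simp

lemma homog_times3:
  fixes A :: "('v, nat) multiproj"
  assumes "homog A 1 F" "homog A 1 G" "homog A 1 H"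
  shows "homog A 3 (\<lambda>x. F x * G x * H x)"
  using homog_times[OF homog_times[OF assms(1,2)] assms(3)] by (simp add: numeral_3_eq_3)

lemma homog_times2:
  fixes A :: "('v, nat) multiproj"
  assumes "homog A 1 F" "homog A 1 G"
  shows "homog A 2 (\<lambda>x. F x * G x)"
  using homog_times[OF assms] by (simp add: numeral_2_eq_2)

lemma homog_fst:
  assumes "homog Proj n F"
  shows "homog P5_P3 (n, 0) (\<lambda>x. F (fst x))"
proof -
  have "homog_lift P5_P3 Proj (\<lambda>n. (n, 0)) fst"
    by (auto simp: homog_lift_def coord_projective_space biprojective_def zero_prod_def comp_def
        intro!: homog_coord)
  from homog_comp_lift[OF this assms] show ?thesis .
qed

lemma homog_snd:
  assumes "homog Proj n F"
  shows "homog P5_P3 (0, n) (\<lambda>x. F (snd x))"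
proof -
  have "homog_lift P5_P3 Proj (\<lambda>n. (0, n)) snd"
    by (auto simp: homog_lift_def coord_projective_space biprojective_def zero_prod_def comp_def
        intro!: homog_coord)
  from homog_comp_lift[OF this assms] show ?thesis .
qed

lemma multigraded_P5_P3: "multigraded P5_P3"
  by (intro multigraded_biprojective multigraded_projective_space vector_space_vec)

lemma linear_functional_vec:
  fixes x :: "complex ^ 'n"
  assumes "l \<in> linear_functionals (*s)"
  shows "l x = (\<Sum>i\<in>UNIV. x $ i * l (axis i 1))"
proof -
  note l = assms[unfolded linear_functionals_iff[OF vector_space_vec]]
  have "l (\<Sum>i\<in>I. x $ i *s axis i 1) = (\<Sum>i\<in>I. x $ i * l (axis i 1))" if "finite I" for I
    using that
  proof (induction I rule: finite_induct)
    case empty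
    have "l (0 *s 0) = 0 * l 0" using l by blast
    then show ?case by simp
  qed (use l in auto)
  then have "l (\<Sum>i\<in>UNIV. x $ i *s axis i 1) = (\<Sum>i\<in>UNIV. x $ i * l (axis i 1))" by simp
  then show ?thesis unfolding basis_expansion .
qed

lemma homog_linear_functional_vec:
  fixes f :: "'v \<Rightarrow> complex ^ 'n"
  assumes "l \<in> linear_functionals (*s)" "\<And>i. homog A d (\<lambda>x. f x $ i)"
  shows "homog A d (\<lambda>x. l (f x))"
proof -
  have "homog A d (\<lambda>x. \<Sum>i\<in>I. f x $ i * l (axis i 1))" if "finite I" for I
    using that
  proof (induction I rule: finite_induct)
    case empty
    show ?case using homog_zero[OF assms(2)] by simp
  next
    case (insert i I)
    then show ?case
      using homog.add[OF homog_cmult[OF assms(2)[of i], of "l (axis i 1)"]]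
      by (simp add: mult.commute)
  qed
  then show ?thesis by (simp add: linear_functional_vec[OF assms(1), of "f _"])
qed

text \<open>Components within one factor must share a degree, while the two factors may differ. The
  degrees that occur below are 3 for the first factor and 1 or 2 for the second.\<close>

lemma homog_lift_vectors:
  fixes A :: "('v, nat) multiproj"
  assumes "homog A a f1" "homog A a f2" "homog A a f3" "homog A a f4" "homog A a f5" "homog A a f6"
    and "homog A b g1" "homog A b g2" "homog A b g3" "homog A b g4"
  shows "homog_lift A P5_P3 (\<lambda>(i, j). i * a + j * b)
    (\<lambda>x. (vector [f1 x, f2 x, f3 x, f4 x, f5 x, f6 x], vector [g1 x, g2 x, g3 x, g4 x]))"
proof -
  have f: "homog A a (\<lambda>x. (vector [f1 x, f2 x, f3 x, f4 x, f5 x, f6 x] :: complex ^ 6) $ i)" for i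
    using exhaust_6[of i] assms by auto
  have g: "homog A b (\<lambda>x. (vector [g1 x, g2 x, g3 x, g4 x] :: complex ^ 4) $ i)" for i
    using exhaust_4[of i] assms by auto
  show ?thesis
    using homog_linear_functional_vec[OF _ f] homog_linear_functional_vec[OF _ g]
    by (auto simp: homog_lift_def coord_projective_space biprojective_def add_mult_distrib
        zero_prod_def)
qed

text \<open>The common shape of the three targets: \<open>G\<close> and \<open>H\<close> cut out a
  line or the conic, and \<open>F\<close> is the product of two coordinates whose vanishing locus on
  that curve consists of the two removed points.\<close>

definition cone_points ::
  "(complex ^ 4 \<Rightarrow> complex) \<Rightarrow> (complex ^ 4 \<Rightarrow> complex) \<Rightarrow> (complex ^ 4 \<Rightarrow> complex) \<Rightarrow>
   ((complex ^ 6) \<times> (complex ^ 4)) set set" where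
  "cone_points F G H = {proj_class (*s) y \<times> proj_class (*s) x | y x.
     y $ 1 \<noteq> 0 \<and> F x \<noteq> 0 \<and> G x = 0 \<and> H x = 0}"

lemma cone_points_eq:
  assumes F: "homog Proj d F" "F 0 = 0" and G: "homog Proj e G" and H: "homog Proj e' H"
  shows "cone_points F G H =
    {p \<in> points P5_P3. \<forall>x\<in>p. fst x $ 1 \<noteq> 0} \<inter> {p \<in> points P5_P3. \<forall>x\<in>p. F (snd x) \<noteq> 0} \<inter>
    ({p \<in> points P5_P3. \<forall>x\<in>p. G (snd x) = 0} \<inter> {p \<in> points P5_P3. \<forall>x\<in>p. H (snd x) = 0})"
    (is "_ = ?C")
proof -
  note nth1 = homog_fst[OF homog_nth[of "1::6"]]
  show ?thesis
  proof (intro equalityI subsetI)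
    fix p assume "p \<in> cone_points F G H"
    then obtain y x where p: "p = proj_class (*s) y \<times> proj_class (*s) x"
      and yx: "y $ 1 \<noteq> 0" "F x \<noteq> 0" "G x = 0" "H x = 0"
      unfolding cone_points_def by blast
    \<comment> \<open>Nonzero constants are homogeneous of degree 0, so \<open>F 0 = 0\<close> is
      what makes a vector with \<open>F x \<noteq> 0\<close> represent a point.\<close>
    have "y \<noteq> 0" "x \<noteq> 0" using yx F(2) by auto
    then have pts: "p \<in> points P5_P3"
      unfolding p biprojective_def point_prod_def points_projective_space by auto
    have mem: "(y, x) \<in> p" unfolding p by (simp add: proj_class_self[OF vector_space_vec])
    show "p \<in> ?C"
      using pts yx homog_zero_all_iff[OF multigraded_P5_P3 pts mem nth1]
        homog_zero_all_iff[OF multigraded_P5_P3 pts mem homog_snd[OF F(1)]]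
        homog_zero_all_iff[OF multigraded_P5_P3 pts mem homog_snd[OF G]]
        homog_zero_all_iff[OF multigraded_P5_P3 pts mem homog_snd[OF H]] by auto
  next
    fix p assume p: "p \<in> ?C"
    then obtain y x where yx: "p = proj_class (*s) y \<times> proj_class (*s) x"
      unfolding biprojective_def point_prod_def points_projective_space by auto
    then have "(y, x) \<in> p" by (simp add: proj_class_self[OF vector_space_vec])
    then have "y $ 1 \<noteq> 0" "F x \<noteq> 0" "G x = 0" "H x = 0" using p by auto
    then show "p \<in> cone_points F G H" using yx unfolding cone_points_def by blast
  qed
qed

lemma locally_closed_cone_points:
  assumes "homog Proj d F" "F 0 = 0" "homog Proj e G" "homog Proj e' H"
  shows "locally_closed P5_P3 (cone_points F G H)"
proof -
  show ?thesis
    unfolding locally_closed_def cone_points_eq[OF assms]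
    using openin_Int[OF openin_zariski_nonzero[OF homog_fst[OF homog_nth[of "1::6"]]]
        openin_zariski_nonzero[OF homog_snd[OF assms(1)]]]
      closedin_Int[OF closedin_zariski_zero[OF multigraded_P5_P3 homog_snd[OF assms(3)]]
        closedin_zariski_zero[OF multigraded_P5_P3 homog_snd[OF assms(4)]]]
    by blast
qed

text \<open>The definition speaks of one representative; by homogeneity the conditions pass to every
  pair of coordinates of the point.\<close>

lemma cone_points_memD:
  assumes "homog Proj d F" "F 0 = 0" "homog Proj e G" "homog Proj e' H"
    and q: "q \<in> cone_points F G H" "(y, x) \<in> q"
  shows "y $ 1 \<noteq> 0" "F x \<noteq> 0" "G x = 0" "H x = 0" "q = proj_class (*s) y \<times> proj_class (*s) x"
proof -
  show "y $ 1 \<noteq> 0" "F x \<noteq> 0" "G x = 0" "H x = 0"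
    using q unfolding cone_points_eq[OF assms(1-4)] by auto
  obtain y' x' where q': "q = proj_class (*s) y' \<times> proj_class (*s) x'"
    using q(1) unfolding cone_points_def by blast
  then have "y \<in> proj_class (*s) y'" "x \<in> proj_class (*s) x'" using q(2) by auto
  then show "q = proj_class (*s) y \<times> proj_class (*s) x"
    unfolding q' using proj_class_memD[OF vector_space_vec] by metis
qed

section \<open>Orbits parametrised by a cone\<close>

text \<open>The lift of the parametrisation: \<open>y\<close> holds the homogenised unipotent matrix
  and \<open>x\<close> the position in the pencil spanned by the two forms.\<close>

definition pencil_pullback :: "('a \<Rightarrow> complex ^ 4 ^ 4) \<Rightarrow> one_form \<Rightarrow> one_form \<Rightarrow>
    ('b \<Rightarrow> complex) \<Rightarrow> ('b \<Rightarrow> complex) \<Rightarrow> 'a \<times> 'b \<Rightarrow> one_form" where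
  "pencil_pullback M \<eta> \<theta> \<alpha> \<beta> =
     (\<lambda>(y, x). pullback (M y) (scale_form (\<alpha> x) \<eta> + scale_form (\<beta> x) \<theta>))"

lemma pencil_pullback_lift:
  fixes M :: "complex ^ 6 \<Rightarrow> complex ^ 4 ^ 4"
  assumes M: "\<And>i j. homog Proj 1 (\<lambda>y. M y $ i $ j)"
    and ab: "homog Proj 1 \<alpha>" "homog Proj 1 \<beta>"
    and forms: "\<eta> \<in> {\<omega>\<^sub>1, \<omega>\<^sub>2, \<omega>\<^sub>3}" "\<theta> \<in> {\<omega>\<^sub>1, \<omega>\<^sub>2, \<omega>\<^sub>3}"
  shows "homog_lift P5_P3 form_space (\<lambda>n. (4 * n, n)) (pencil_pullback M \<eta> \<theta> \<alpha> \<beta>)"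
proof (rule homog_lift_family)
  note fam = homog_family_homog_times[OF homog_snd homog_family_pullback_omega[OF homog_fst[OF M]]]
  have deg: "(0, 1) + ((1, 0) + ((1, 0) + ((1, 0) + (1, 0)))) = (4 * 1 :: nat, 1 :: nat)"
    by simp
  have "homog_family P5_P3 (4 * 1, 1)
    (\<lambda>x z v. \<alpha> (snd x) * pullback (M (fst x)) \<eta> z v + \<beta> (snd x) * pullback (M (fst x)) \<theta> z v)"
    unfolding deg[symmetric]
    by (intro homog_family.add fam ab forms)
  then show "homog_family P5_P3 (4 * 1, 1) (pencil_pullback M \<eta> \<theta> \<alpha> \<beta>)"
    by (simp add: pencil_pullback_def case_prod_unfold pullback_def scale_form_def plus_fun_def)
qed (auto simp: zero_prod_def)

lemma pullback_add: "pullback g (\<eta> + \<theta>) = pullback g \<eta> + pullback g \<theta>"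
  by (simp add: pullback_def fun_eq_iff)

lemma pullback_scale: "pullback g (scale_form c \<eta>) = scale_form c (pullback g \<eta>)"
  by (simp add: pullback_def scale_form_def)

text \<open>This reduces the isomorphism to statements about coordinates. The factors
  \<open>a\<close> and \<open>b\<close> in \<open>retract\<close> are independent because a point of
  the product is a pair of classes.\<close>

lemma orbit_isomorphism:
  fixes M :: "complex ^ 6 \<Rightarrow> complex ^ 4 ^ 4" and \<eta> \<theta> \<alpha> \<beta>
  defines "\<Phi> \<equiv> pencil_pullback M \<eta> \<theta> \<alpha> \<beta>"
  assumes cone: "homog Proj d F" "F 0 = 0" "homog Proj e G" "homog Proj e' H"
    and M: "\<And>i j. homog Proj 1 (\<lambda>y. M y $ i $ j)"
    and ab: "homog Proj 1 \<alpha>" "homog Proj 1 \<beta>"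
    and forms: "\<eta> \<in> {\<omega>\<^sub>1, \<omega>\<^sub>2, \<omega>\<^sub>3}" "\<theta> \<in> {\<omega>\<^sub>1, \<omega>\<^sub>2, \<omega>\<^sub>3}"
    and lift: "homog_lift form_space P5_P3 D \<Phi>'"
    and kappa: "homog form_space k \<kappa>" "\<kappa> 0 = 0"
    and orbit: "\<And>g. g \<in> P \<Longrightarrow>
      \<exists>y x. y $ 1 \<noteq> 0 \<and> F x \<noteq> 0 \<and> G x = 0 \<and> H x = 0 \<and> pullback g (\<eta> + \<theta>) = \<Phi> (y, x)"
    and orbit': "\<And>y x. y $ 1 \<noteq> 0 \<Longrightarrow> F x \<noteq> 0 \<Longrightarrow> G x = 0 \<Longrightarrow> H x = 0 \<Longrightarrow>
      \<exists>g\<in>P. \<exists>c. c \<noteq> 0 \<and> \<Phi> (y, x) = scale_form c (pullback g (\<eta> + \<theta>))"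
    and kappa_nz: "\<And>y x. y $ 1 \<noteq> 0 \<Longrightarrow> F x \<noteq> 0 \<Longrightarrow> G x = 0 \<Longrightarrow> H x = 0 \<Longrightarrow> \<kappa> (\<Phi> (y, x)) \<noteq> 0"
    and retract: "\<And>y x c. y $ 1 \<noteq> 0 \<Longrightarrow> F x \<noteq> 0 \<Longrightarrow> G x = 0 \<Longrightarrow> H x = 0 \<Longrightarrow> c \<noteq> 0 \<Longrightarrow>
      \<exists>a b. a \<noteq> 0 \<and> b \<noteq> 0 \<and> \<Phi>' (scale_form c (\<Phi> (y, x))) = (a *s y, b *s x)"
    and into: "\<And>\<zeta>. \<kappa> \<zeta> \<noteq> 0 \<Longrightarrow> fst (\<Phi>' \<zeta>) $ 1 \<noteq> 0 \<and> F (snd (\<Phi>' \<zeta>)) \<noteq> 0 \<and>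
      G (snd (\<Phi>' \<zeta>)) = 0 \<and> H (snd (\<Phi>' \<zeta>)) = 0"
  shows "isomorphic_varieties form_space (P_orbit (\<eta> + \<theta>)) P5_P3 (cone_points F G H)"
proof -
  note vs = vector_space_scale_form
  note memD = cone_points_memD[OF cone]
  have cone_mem: "proj_class (*s) y \<times> proj_class (*s) x \<in> cone_points F G H"
      "(y, x) \<in> proj_class (*s) y \<times> proj_class (*s) x"
    if "y $ 1 \<noteq> 0" "F x \<noteq> 0" "G x = 0" "H x = 0" for y x
    using that by (auto simp: cone_points_def proj_class_self[OF vector_space_vec])
  have "P_orbit (\<eta> + \<theta>) = {proj_class scale_form (\<Phi> y) | y q. q \<in> cone_points F G H \<and> y \<in> q}"
  proof (intro equalityI subsetI)
    fix p assume "p \<in> P_orbit (\<eta> + \<theta>)"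
    then obtain g where "g \<in> P" "p = proj_class scale_form (pullback g (\<eta> + \<theta>))"
      unfolding P_orbit_pullback by blast
    then show "p \<in> {proj_class scale_form (\<Phi> y) | y q. q \<in> cone_points F G H \<and> y \<in> q}"
      using orbit[of g] cone_mem by fastforce
  next
    fix p assume "p \<in> {proj_class scale_form (\<Phi> y) | y q. q \<in> cone_points F G H \<and> y \<in> q}"
    then obtain y x q where p: "p = proj_class scale_form (\<Phi> (y, x))"
      and q: "q \<in> cone_points F G H" "(y, x) \<in> q"
      by auto
    obtain g c where "g \<in> P" "c \<noteq> 0" "\<Phi> (y, x) = scale_form c (pullback g (\<eta> + \<theta>))"
      using orbit'[OF memD(1-4)[OF q]] by blast
    then show "p \<in> P_orbit (\<eta> + \<theta>)"
      unfolding p P_orbit_pullback using proj_class_eqI[OF vs] by blast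
  qed
  moreover have "isomorphic_varieties form_space
      {proj_class scale_form (\<Phi> y) | y q. q \<in> cone_points F G H \<and> y \<in> q} P5_P3 (cone_points F G H)"
  proof (rule isomorphic_varieties_lifts[OF multigraded_P5_P3 locally_closed_cone_points[OF cone] _ lift kappa(1)])
    show "homog_lift P5_P3 form_space (\<lambda>n. (4 * n, n)) \<Phi>"
      unfolding \<Phi>_def by (rule pencil_pullback_lift[OF M ab forms])
    fix q and w :: "(complex ^ 6) \<times> (complex ^ 4)"
    assume q: "q \<in> cone_points F G H" "w \<in> q"
    obtain y x where w: "w = (y, x)" by (cases w)
    note yx = memD[OF q[unfolded w]]
    show nz: "\<kappa> (\<Phi> w) \<noteq> 0" unfolding w using kappa_nz yx by blast
    have "\<Phi> w \<in> twisted_forms"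
      using forms twisted_omega unfolding w \<Phi>_def pencil_pullback_def
      by (auto intro!: twisted_forms_pullback twisted_forms_add twisted_forms_scale)
    then show "\<Phi> w \<in> twisted_forms - {0}" using nz kappa(2) by auto
    show "\<Phi>' (scale_form c (\<Phi> w)) \<in> q" if "c \<noteq> 0" for c
      using retract[OF yx(1-4) that] unfolding w yx(5) by (auto simp: proj_class_def)
  next
    fix \<zeta> assume "\<kappa> \<zeta> \<noteq> 0"
    note yx = into[OF this]
    show "\<exists>q\<in>cone_points F G H. \<Phi>' \<zeta> \<in> q"
      using cone_mem[of "fst (\<Phi>' \<zeta>)" "snd (\<Phi>' \<zeta>)"] yx
      by (intro bexI[of _ "proj_class (*s) (fst (\<Phi>' \<zeta>)) \<times> proj_class (*s) (snd (\<Phi>' \<zeta>))"]) simp_all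
  qed
  ultimately show ?thesis by simp
qed

section \<open>Coefficients of the pencils\<close>

text \<open>The coefficients of \<open>z\<^sub>i\<^sup>3\<close>, \<open>z\<^sub>i\<^sup>2 z\<^sub>j\<close> and \<open>z\<^sub>i z\<^sub>j z\<^sub>k\<close> in the coefficient of \<open>dz\<^sub>4\<close>, as
  combinations of values so that they are linear functionals on all functions.\<close>

definition dz4_at :: "complex ^ 4 \<Rightarrow> one_form \<Rightarrow> complex" where
  "dz4_at z \<eta> = \<eta> z (axis 4 1)"

definition coef3 :: "4 \<Rightarrow> one_form \<Rightarrow> complex" where
  "coef3 i \<eta> = dz4_at (axis i 1) \<eta>"

definition coef21 :: "4 \<Rightarrow> 4 \<Rightarrow> one_form \<Rightarrow> complex" where
  "coef21 i j \<eta> =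
     (dz4_at (axis i 1 + axis j 1) \<eta> + dz4_at (axis j 1 - axis i 1) \<eta>) / 2 - dz4_at (axis j 1) \<eta>"

definition coef111 :: "4 \<Rightarrow> 4 \<Rightarrow> 4 \<Rightarrow> one_form \<Rightarrow> complex" where
  "coef111 i j k \<eta> = dz4_at (axis i 1 + axis j 1 + axis k 1) \<eta>
     - dz4_at (axis i 1 + axis j 1) \<eta> - dz4_at (axis i 1 + axis k 1) \<eta> - dz4_at (axis j 1 + axis k 1) \<eta>
     + dz4_at (axis i 1) \<eta> + dz4_at (axis j 1) \<eta> + dz4_at (axis k 1) \<eta>"

lemma homog_dz4_at: "homog form_space 1 (dz4_at z)"
  unfolding dz4_at_def[abs_def] by (rule homog_coord[OF eval_coord])

lemma homog_coef:
  "homog form_space 1 (coef3 i)" "homog form_space 1 (coef21 i j)" "homog form_space 1 (coef111 i j k)"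
  unfolding coef3_def[abs_def] coef21_def[abs_def] coef111_def[abs_def]
  by (intro homog.add homog_diff homog_divide homog_dz4_at)+

lemma coef_scale:
  "coef3 i (scale_form c \<eta>) = c * coef3 i \<eta>"
  "coef21 i j (scale_form c \<eta>) = c * coef21 i j \<eta>"
  "coef111 i j k (scale_form c \<eta>) = c * coef111 i j k \<eta>"
  by (simp_all add: coef3_def coef21_def coef111_def dz4_at_def scale_form_def algebra_simps
      add_divide_distrib)

lemma coef_zero: "coef3 i 0 = 0" "coef21 i j 0 = 0" "coef111 i j k 0 = 0"
  by (simp_all add: coef3_def coef21_def coef111_def dz4_at_def)

lemmas omega_defs = \<omega>\<^sub>1_def \<omega>\<^sub>2_def \<omega>\<^sub>3_def vf_def dz_def
lemmas coef_defs = coef3_def coef21_def coef111_def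

lemma axis_4:
  "(axis 1 1 :: complex ^ 4) $ 1 = 1" "(axis 1 1 :: complex ^ 4) $ 2 = 0" "(axis 1 1 :: complex ^ 4) $ 3 = 0" "(axis 1 1 :: complex ^ 4) $ 4 = 0"
  "(axis 2 1 :: complex ^ 4) $ 1 = 0" "(axis 2 1 :: complex ^ 4) $ 2 = 1" "(axis 2 1 :: complex ^ 4) $ 3 = 0" "(axis 2 1 :: complex ^ 4) $ 4 = 0"
  "(axis 3 1 :: complex ^ 4) $ 1 = 0" "(axis 3 1 :: complex ^ 4) $ 2 = 0" "(axis 3 1 :: complex ^ 4) $ 3 = 1" "(axis 3 1 :: complex ^ 4) $ 4 = 0"
  "(axis 4 1 :: complex ^ 4) $ 1 = 0" "(axis 4 1 :: complex ^ 4) $ 2 = 0" "(axis 4 1 :: complex ^ 4) $ 3 = 0" "(axis 4 1 :: complex ^ 4) $ 4 = 1"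
  by (simp_all add: axis_def)

text \<open>The matrix sends the tangent vector \<open>axis 4 1\<close> to its last column (n, s, p,
  l). What remains is an identity of polynomials.\<close>

lemma dz4_at_pencil_12:
  "dz4_at z (pullback (upper l l l l 0 m n q s p) (scale_form a \<omega>\<^sub>1 + scale_form b \<omega>\<^sub>2)) =
     a * (l^4 * z$2^2 * z$3 - p * l^3 * z$2^2 * z$4 + 2 * q * l^3 * z$2 * z$3^2
       + (3 * s * l^3 - 2 * p * q * l^2) * z$2 * z$3 * z$4 + q^2 * l^2 * z$3^3
       + (3 * q * s * l^2 - p * q^2 * l) * z$3^2 * z$4 - s * p * l^2 * z$2 * z$4^2
       + s * l * (2 * s * l - p * q) * z$3 * z$4^2)
     + b * (- 2 * l^4 * z$1 * z$3^2 - 2 * m * l^3 * z$3^3 - p * l^3 * z$1 * z$3 * z$4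
       - (m * p * l^2 + 3 * n * l^3) * z$3^2 * z$4 + p^2 * l^2 * z$1 * z$4^2
       + p * l * (m * p - 3 * n * l) * z$3 * z$4^2)"
  by (simp add: dz4_at_def pullback_def scale_form_def omega_defs upper_mult_vec axis_def) algebra

lemma dz4_at_pencil_13:
  "dz4_at z (pullback (upper l l l l 0 m n q s p) (scale_form a \<omega>\<^sub>1 + scale_form b \<omega>\<^sub>3)) =
     a * (l^4 * z$2^2 * z$3 - p * l^3 * z$2^2 * z$4 + 2 * q * l^3 * z$2 * z$3^2
       + (3 * s * l^3 - 2 * p * q * l^2) * z$2 * z$3 * z$4 + q^2 * l^2 * z$3^3
       + (3 * q * s * l^2 - p * q^2 * l) * z$3^2 * z$4 - s * p * l^2 * z$2 * z$4^2
       + s * l * (2 * s * l - p * q) * z$3 * z$4^2)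
     + b * (l^4 * z$1 * z$2 * z$4 + m * l^3 * z$2 * z$3 * z$4 + q * l^3 * z$1 * z$3 * z$4
       + q * m * l^2 * z$3^2 * z$4 - 2 * s * l^3 * z$1 * z$4^2 + 3 * n * l^3 * z$2 * z$4^2
       + (3 * n * q - 2 * s * m) * l^2 * z$3 * z$4^2)"
  by (simp add: dz4_at_def pullback_def scale_form_def omega_defs upper_mult_vec axis_def) algebra

lemma dz4_at_pencil_23:
  "dz4_at z (pullback (upper l l l l k m n q s 0) (scale_form a \<omega>\<^sub>2 + scale_form b \<omega>\<^sub>3)) =
     a * (- 2 * l^4 * z$1 * z$3^2 - 2 * k * l^3 * z$2 * z$3^2 - 2 * m * l^3 * z$3^3
       - 3 * n * l^3 * z$3^2 * z$4)
     + b * (l^4 * z$1 * z$2 * z$4 + k * l^3 * z$2^2 * z$4 + (m * l + q * k) * l^2 * z$2 * z$3 * z$4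
       + q * l^3 * z$1 * z$3 * z$4 + q * m * l^2 * z$3^2 * z$4 - 2 * s * l^3 * z$1 * z$4^2
       + (3 * n * l - 2 * k * s) * l^2 * z$2 * z$4^2 + (3 * n * q - 2 * m * s) * l^2 * z$3 * z$4^2)"
  by (simp add: dz4_at_def pullback_def scale_form_def omega_defs upper_mult_vec axis_def) algebra

text \<open>Averaging a cubic over the sign of z_i cancels the terms odd in z_i, and
  inclusion-exclusion over three axes leaves the mixed term; so single coefficients of
  \<open>dz4_at_pencil_12\<close> appear. Given l, the equations yield a, p, b, q, m, s, n in this
  order.\<close>

lemma coef_pencil_12:
  fixes l m n q s p a b :: complex
  defines "\<eta> \<equiv> pullback (upper l l l l 0 m n q s p) (scale_form a \<omega>\<^sub>1 + scale_form b \<omega>\<^sub>2)"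
  shows "coef21 2 3 \<eta> = a * l ^ 4" "coef21 2 4 \<eta> = - a * p * l ^ 3"
    "coef21 3 1 \<eta> = - 2 * b * l ^ 4" "coef21 3 2 \<eta> = 2 * a * q * l ^ 3"
    "coef3 3 \<eta> = a * q\<^sup>2 * l\<^sup>2 - 2 * b * m * l ^ 3"
    "coef111 2 3 4 \<eta> = a * (3 * s * l ^ 3 - 2 * p * q * l\<^sup>2)"
    "coef21 3 4 \<eta> = a * (3 * q * s * l\<^sup>2 - p * q\<^sup>2 * l) - b * (p * m * l\<^sup>2 + 3 * n * l ^ 3)"
  unfolding \<eta>_def
  unfolding coef_defs dz4_at_pencil_12 vector_add_component vector_minus_component axis_4
  by (simp_all add: field_simps)

lemma coef_pencil_13:
  fixes l m n q s p a b :: complex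
  defines "\<eta> \<equiv> pullback (upper l l l l 0 m n q s p) (scale_form a \<omega>\<^sub>1 + scale_form b \<omega>\<^sub>3)"
  shows "coef21 2 3 \<eta> = a * l ^ 4" "coef21 2 4 \<eta> = - a * p * l ^ 3"
    "coef21 3 2 \<eta> = 2 * a * q * l ^ 3" "coef111 1 2 4 \<eta> = b * l ^ 4"
    "coef21 4 1 \<eta> = - 2 * b * s * l ^ 3"
    "coef111 2 3 4 \<eta> = a * (3 * s * l ^ 3 - 2 * p * q * l\<^sup>2) + b * m * l ^ 3"
    "coef21 4 2 \<eta> = 3 * b * n * l ^ 3 - a * s * p * l\<^sup>2"
  unfolding \<eta>_def
  unfolding coef_defs dz4_at_pencil_13 vector_add_component vector_minus_component axis_4
  by (simp_all add: field_simps)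

text \<open>Only the fourth equation mixes the two forms: besides n it contains b q m, which the
  third, fifth and sixth equations supply.\<close>

lemma coef_pencil_23:
  fixes l k m n q s a b :: complex
  defines "\<eta> \<equiv> pullback (upper l l l l k m n q s 0) (scale_form a \<omega>\<^sub>2 + scale_form b \<omega>\<^sub>3)"
  shows "coef21 3 1 \<eta> = - 2 * a * l ^ 4" "coef21 3 2 \<eta> = - 2 * a * k * l ^ 3"
    "coef3 3 \<eta> = - 2 * a * m * l ^ 3"
    "coef21 3 4 \<eta> = - 3 * a * n * l ^ 3 + b * q * m * l\<^sup>2"
    "coef111 1 2 4 \<eta> = b * l ^ 4" "coef111 1 3 4 \<eta> = b * q * l ^ 3"
    "coef21 4 1 \<eta> = - 2 * b * s * l ^ 3"
  unfolding \<eta>_def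
  unfolding coef_defs dz4_at_pencil_23 vector_add_component vector_minus_component axis_4
  by (simp_all add: field_simps)

section \<open>The three orbits\<close>

lemma pullback_scalar:
  assumes "\<eta> \<in> {\<omega>\<^sub>1, \<omega>\<^sub>2, \<omega>\<^sub>3}"
  shows "pullback (upper l l l l 0 0 0 0 0 0) \<eta> = scale_form (l ^ 4) \<eta>"
  using assms
  by (elim insertE emptyE; intro ext; simp add: pullback_def scale_form_def omega_defs
      upper_mult_vec power4_eq_xxxx algebra_simps)

text \<open>In the next three lemmas the matrix is \<open>u diag(a, b, c, d)\<close> with \<open>u\<close> in the one-parameter group
  generated by \<open>E\<^sub>1\<^sub>2 + E\<^sub>2\<^sub>3\<close>, \<open>E\<^sub>1\<^sub>2 + E\<^sub>3\<^sub>4\<close> and \<open>E\<^sub>2\<^sub>3 + E\<^sub>3\<^sub>4\<close> respectively, which fixes the form.\<close>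

lemma pullback_stabilizer_12:
  "pullback (upper a b c d (r * b) (r\<^sup>2 / 2 * c) 0 (r * c) 0 0) (\<omega>\<^sub>1 + \<omega>\<^sub>2) =
   scale_form (b\<^sup>2 * c * d) \<omega>\<^sub>1 + scale_form (a * c\<^sup>2 * d) \<omega>\<^sub>2"
  by (intro ext)
    (simp add: pullback_def scale_form_def omega_defs upper_mult_vec field_simps power2_eq_square)

lemma pullback_stabilizer_13:
  "pullback (upper a b c d (r * b) 0 0 0 0 (r * d)) (\<omega>\<^sub>1 + \<omega>\<^sub>3) =
   scale_form (b\<^sup>2 * c * d) \<omega>\<^sub>1 + scale_form (a * b * d\<^sup>2) \<omega>\<^sub>3"
  by (intro ext)
    (simp add: pullback_def scale_form_def omega_defs upper_mult_vec field_simps power2_eq_square)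

lemma pullback_stabilizer_23:
  "pullback (upper a b c d 0 0 0 (r * c) (r\<^sup>2 / 2 * d) (r * d)) (\<omega>\<^sub>2 + \<omega>\<^sub>3) =
   scale_form (a * c\<^sup>2 * d) \<omega>\<^sub>2 + scale_form (a * b * d\<^sup>2) \<omega>\<^sub>3"
  by (intro ext)
    (simp add: pullback_def scale_form_def omega_defs upper_mult_vec field_simps power2_eq_square)

text \<open>The scalar l contributes only the factor l^4, which leaves a unipotent matrix. A
  diagonal matrix of determinant one then has to realise just the ratio of \<alpha> and
  \<beta>.\<close>

lemma pencil_in_orbit:
  assumes forms: "\<eta> \<in> {\<omega>\<^sub>1, \<omega>\<^sub>2, \<omega>\<^sub>3}" "\<theta> \<in> {\<omega>\<^sub>1, \<omega>\<^sub>2, \<omega>\<^sub>3}" and "l \<noteq> 0"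
    and torus: "a * b * c * d = 1"
      "pullback (upper a b c d 0 0 0 0 0 0) (\<eta> + \<theta>) = scale_form t \<eta> + scale_form t' \<theta>"
    and ratio: "e \<noteq> 0" "\<alpha> = e * t" "\<beta> = e * t'"
  shows "\<exists>g\<in>P. \<exists>e. e \<noteq> 0 \<and>
    pullback (upper l l l l k m n q s p) (scale_form \<alpha> \<eta> + scale_form \<beta> \<theta>) =
    scale_form e (pullback g (\<eta> + \<theta>))"
proof -
  let ?N = "upper 1 1 1 1 (k / l) (m / l) (n / l) (q / l) (s / l) (p / l)"
  let ?g = "upper a b c d 0 0 0 0 0 0 ** ?N"
  have "upper l l l l k m n q s p = upper l l l l 0 0 0 0 0 0 ** ?N"
    using \<open>l \<noteq> 0\<close> by (simp add: upper_mult)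
  then have "pullback (upper l l l l k m n q s p) (scale_form \<alpha> \<eta> + scale_form \<beta> \<theta>) =
    pullback ?N (scale_form (l ^ 4) (scale_form \<alpha> \<eta> + scale_form \<beta> \<theta>))"
    by (simp add: pullback_mult pullback_add pullback_scale pullback_scalar[OF forms(1)]
        pullback_scalar[OF forms(2)]) (simp add: scale_form_def fun_eq_iff pullback_def algebra_simps)
  also have "\<dots> = scale_form (l ^ 4 * e) (pullback ?N (scale_form t \<eta> + scale_form t' \<theta>))"
    unfolding ratio by (simp add: scale_form_def fun_eq_iff pullback_def algebra_simps)
  also have "\<dots> = scale_form (l ^ 4 * e) (pullback ?g (\<eta> + \<theta>))"
    by (simp add: pullback_mult torus(2))
  finally have eq: "pullback (upper l l l l k m n q s p) (scale_form \<alpha> \<eta> + scale_form \<beta> \<theta>) =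
    scale_form (l ^ 4 * e) (pullback ?g (\<eta> + \<theta>))" .
  have "?g \<in> P" unfolding P_iff upper_mult mult_1_right using torus(1) by blast
  moreover have "l ^ 4 * e \<noteq> 0" using \<open>l \<noteq> 0\<close> \<open>e \<noteq> 0\<close> by simp
  ultimately show ?thesis using eq by blast
qed

lemma homog_upper:
  assumes "homog A 1 a" "homog A 1 k" "homog A 1 m" "homog A 1 n" "homog A 1 q" "homog A 1 s"
    "homog A 1 p"
  shows "homog A 1 (\<lambda>x. upper (a x) (a x) (a x) (a x) (k x) (m x) (n x) (q x) (s x) (p x) $ i $ j)"
  using exhaust_4[of i] exhaust_4[of j] assms homog_zero[OF assms(1)]
  by (elim disjE; simp add: upper_def)

lemma vec_eq_4: "(x :: complex ^ 4) = y \<longleftrightarrow> x$1 = y$1 \<and> x$2 = y$2 \<and> x$3 = y$3 \<and> x$4 = y$4"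
  by (simp add: vec_eq_iff forall_4)

lemma vec_eq_6: "(x :: complex ^ 6) = y \<longleftrightarrow>
    x$1 = y$1 \<and> x$2 = y$2 \<and> x$3 = y$3 \<and> x$4 = y$4 \<and> x$5 = y$5 \<and> x$6 = y$6"
  by (simp add: vec_eq_iff forall_6)

text \<open>Unipotent matrices are taken modulo the stabilizer with entry \<open>x\<^sub>1\<^sub>2 = 0\<close> in the first two of the
  following lemmas and \<open>x\<^sub>3\<^sub>4 = 0\<close> in the third. The formulas in \<open>\<Phi>'\<close> solve the equations
  \<open>coef_pencil_12\<close> etc. for the coordinates, with the denominators cleared.\<close>

lemma orbit_12:
  "isomorphic_varieties form_space (P_orbit (\<omega>\<^sub>1 + \<omega>\<^sub>2)) P5_P3
     (cone_points (\<lambda>x. x $ 3 * x $ 4) (\<lambda>x. x $ 1) (\<lambda>x. x $ 2))"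
proof -
  define M where "M = (\<lambda>y :: complex ^ 6.
    upper (y $ 1) (y $ 1) (y $ 1) (y $ 1) 0 (y $ 2) (y $ 3) (y $ 4) (y $ 5) (y $ 6))"
  define \<Phi> where "\<Phi> = pencil_pullback M \<omega>\<^sub>1 \<omega>\<^sub>2 (\<lambda>x :: complex ^ 4. x $ 3) (\<lambda>x. x $ 4)"
  define A B C E F G H where K_defs: "A = coef21 2 3" "B = coef21 2 4" "C = coef21 3 1"
    "E = coef21 3 2" "F = coef3 3" "G = coef111 2 3 4" "H = coef21 3 4"
  \<comment> \<open>The leading entry A A C is a common denominator of the five matrix entries, and
    -1/2 undoes the factor -2 in \<open>C\<close>. Zero coordinates are written
    \<open>0 * A \<zeta>\<close> to carry the same degree as the others.\<close>
  define \<Phi>' where "\<Phi>' = (\<lambda>\<zeta>.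
    (vector [A \<zeta> * A \<zeta> * C \<zeta>, A \<zeta> * A \<zeta> * F \<zeta> - 1/4 * (A \<zeta> * E \<zeta> * E \<zeta>),
      1/3 * (1/4 * (B \<zeta> * E \<zeta> * E \<zeta>) + A \<zeta> * B \<zeta> * F \<zeta> + 2 * (A \<zeta> * A \<zeta> * H \<zeta>) - A \<zeta> * E \<zeta> * G \<zeta>),
      1/2 * (A \<zeta> * C \<zeta> * E \<zeta>), 1/3 * (A \<zeta> * C \<zeta> * G \<zeta> - B \<zeta> * C \<zeta> * E \<zeta>),
      - 1 * (A \<zeta> * B \<zeta> * C \<zeta>)] :: complex ^ 6,
     vector [0 * A \<zeta>, 0 * A \<zeta>, A \<zeta>, (-1/2) * C \<zeta>] :: complex ^ 4))"
  have hK: "homog form_space 1 A" "homog form_space 1 B" "homog form_space 1 C" "homog form_space 1 E"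
    "homog form_space 1 F" "homog form_space 1 G" "homog form_space 1 H"
    unfolding K_defs by (rule homog_coef)+
  have coef: "A (scale_form c (\<Phi> (y, x))) = c * (x $ 3 * y $ 1 ^ 4)"
    "B (scale_form c (\<Phi> (y, x))) = c * (- x $ 3 * y $ 6 * y $ 1 ^ 3)"
    "C (scale_form c (\<Phi> (y, x))) = c * (- 2 * x $ 4 * y $ 1 ^ 4)"
    "E (scale_form c (\<Phi> (y, x))) = c * (2 * x $ 3 * y $ 4 * y $ 1 ^ 3)"
    "F (scale_form c (\<Phi> (y, x))) = c * (x $ 3 * (y $ 4)\<^sup>2 * (y $ 1)\<^sup>2 - 2 * x $ 4 * y $ 2 * y $ 1 ^ 3)"
    "G (scale_form c (\<Phi> (y, x))) = c * (x $ 3 * (3 * y $ 5 * y $ 1 ^ 3 - 2 * y $ 6 * y $ 4 * (y $ 1)\<^sup>2))"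
    "H (scale_form c (\<Phi> (y, x))) =
      c * (x $ 3 * (3 * y $ 4 * y $ 5 * (y $ 1)\<^sup>2 - y $ 6 * (y $ 4)\<^sup>2 * y $ 1)
        - x $ 4 * (y $ 6 * y $ 2 * (y $ 1)\<^sup>2 + 3 * y $ 3 * y $ 1 ^ 3))" for c x y
    unfolding K_defs \<Phi>_def M_def pencil_pullback_def prod.case coef_scale coef_pencil_12 by (rule refl)+
  show ?thesis
  proof (rule orbit_isomorphism[where M = M and \<Phi>' = \<Phi>' and \<kappa> = "\<lambda>\<zeta>. A \<zeta> * C \<zeta>"
        and \<eta> = \<omega>\<^sub>1 and \<theta> = \<omega>\<^sub>2 and \<alpha> = "\<lambda>x. x $ 3" and \<beta> = "\<lambda>x. x $ 4", folded \<Phi>_def])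
    show "homog Proj 2 (\<lambda>x :: complex ^ 4. x $ 3 * x $ 4)"
      by (intro homog_times2 homog_nth)
    show "homog Proj 1 (\<lambda>y. M y $ i $ j)" for i j
      unfolding M_def by (intro homog_upper homog_nth homog_zero[OF homog_nth])
    show "homog_lift form_space P5_P3 (\<lambda>(i, j). i * 3 + j * 1) \<Phi>'"
      unfolding \<Phi>'_def
      by (intro homog_lift_vectors homog.add homog_diff homog_cmult homog_times3 hK)
    show "homog form_space 2 (\<lambda>\<zeta>. A \<zeta> * C \<zeta>)" by (intro homog_times2 hK)
    show "A 0 * C 0 = 0" unfolding K_defs coef_zero by simp
  next
    fix g assume "g \<in> P"
    then obtain a b c d k m n q s p where g: "g = upper a b c d k m n q s p" and "a * b * c * d = 1"
      unfolding P_iff by blast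
    then have nz: "a \<noteq> 0" "b \<noteq> 0" "c \<noteq> 0" "d \<noteq> 0" by auto
    \<comment> \<open>The stabilizer factor alone has to produce the entry (1, 2) of
      \<open>g\<close>; the other entries are then solved from the lower rows upwards.\<close>
    define r where "r = k / b"
    define p' q' where "p' = p / c" "q' = (q - r * c) / b"
    define s' where "s' = (s - r * c * p') / b"
    define m' n' where "m' = (m - r * b * q' - r\<^sup>2 / 2 * c) / a"
      "n' = (n - r * b * s' - r\<^sup>2 / 2 * c * p') / a"
    let ?y = "vector [1, m', n', q', s', p'] :: complex ^ 6"
    let ?x = "vector [0, 0, b\<^sup>2 * c * d, a * c\<^sup>2 * d] :: complex ^ 4"
    have "g = upper a b c d (r * b) (r\<^sup>2 / 2 * c) 0 (r * c) 0 0 ** M ?y"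
      unfolding g M_def vector_6 upper_mult using nz
      by (simp add: r_def p'_q'_def s'_def m'_n'_def)
    then have "pullback g (\<omega>\<^sub>1 + \<omega>\<^sub>2) = \<Phi> (?y, ?x)"
      by (simp only: pullback_mult pullback_stabilizer_12 \<Phi>_def pencil_pullback_def prod.case vector_4)
    then show "\<exists>y x. y $ 1 \<noteq> 0 \<and> x $ 3 * x $ 4 \<noteq> 0 \<and> x $ 1 = 0 \<and> x $ 2 = 0 \<and>
        pullback g (\<omega>\<^sub>1 + \<omega>\<^sub>2) = \<Phi> (y, x)"
      using nz by (intro exI[of _ ?y] exI[of _ ?x]) simp
  next
    fix y :: "complex ^ 6" and x :: "complex ^ 4"
    assume y: "y $ 1 \<noteq> 0" and x: "x $ 3 * x $ 4 \<noteq> 0" and x12: "x $ 1 = 0" "x $ 2 = 0"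
    show "\<exists>g\<in>P. \<exists>c. c \<noteq> 0 \<and> \<Phi> (y, x) = scale_form c (pullback g (\<omega>\<^sub>1 + \<omega>\<^sub>2))"
      unfolding \<Phi>_def pencil_pullback_def prod.case M_def
    proof (rule pencil_in_orbit[OF _ _ y])
      \<comment> \<open>The weights b^2 c d and a c^2 d of this diagonal matrix are x_3 / x_4 and 1;
        multiplying by x_4 gives the required pair.\<close>
      show "pullback (upper (x $ 4 / x $ 3) 1 1 (x $ 3 / x $ 4) 0 0 0 0 0 0) (\<omega>\<^sub>1 + \<omega>\<^sub>2) =
          scale_form (x $ 3 / x $ 4) \<omega>\<^sub>1 + scale_form 1 \<omega>\<^sub>2"
        using pullback_stabilizer_12[of "x $ 4 / x $ 3" 1 1 "x $ 3 / x $ 4" 0] x by simp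
    qed (use x in auto)
    show "A (\<Phi> (y, x)) * C (\<Phi> (y, x)) \<noteq> 0"
      using coef(1,3)[of 1 y x] x y by (simp add: scale_form_def)
    fix c :: complex assume c: "c \<noteq> 0"
    \<comment> \<open>The factors are read off from single components: A A C is the first factor
      times y_1, and A is the second times x_3.\<close>
    have "\<Phi>' (scale_form c (\<Phi> (y, x))) =
        ((- 2 * c ^ 3 * (x $ 3)\<^sup>2 * x $ 4 * y $ 1 ^ 11) *s y, (c * y $ 1 ^ 4) *s x)"
      unfolding \<Phi>'_def coef prod.inject vec_eq_4 vec_eq_6 vector_4 vector_6 vector_smult_component x12
      by (intro conjI; (algebra | simp add: field_simps power2_eq_square power3_eq_cube))
    moreover have "- 2 * c ^ 3 * (x $ 3)\<^sup>2 * x $ 4 * y $ 1 ^ 11 \<noteq> 0" "c * y $ 1 ^ 4 \<noteq> 0"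
      using c x y by simp_all
    ultimately show "\<exists>a b. a \<noteq> 0 \<and> b \<noteq> 0 \<and> \<Phi>' (scale_form c (\<Phi> (y, x))) = (a *s y, b *s x)"
      by blast
  next
    fix \<zeta> assume "A \<zeta> * C \<zeta> \<noteq> 0"
    then show "fst (\<Phi>' \<zeta>) $ 1 \<noteq> 0 \<and> snd (\<Phi>' \<zeta>) $ 3 * snd (\<Phi>' \<zeta>) $ 4 \<noteq> 0 \<and>
        snd (\<Phi>' \<zeta>) $ 1 = 0 \<and> snd (\<Phi>' \<zeta>) $ 2 = 0"
      by (simp add: \<Phi>'_def)
  qed (use homog_nth in auto)
qed

lemma orbit_13:
  "isomorphic_varieties form_space (P_orbit (\<omega>\<^sub>1 + \<omega>\<^sub>3)) P5_P3
     (cone_points (\<lambda>x. x $ 1 * x $ 3) (\<lambda>x. x $ 4) (\<lambda>x. x $ 1 * x $ 3 - x $ 2 * x $ 2))"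
proof -
  define M where "M = (\<lambda>y :: complex ^ 6.
    upper (y $ 1) (y $ 1) (y $ 1) (y $ 1) 0 (y $ 2) (y $ 3) (y $ 4) (y $ 5) (y $ 6))"
  \<comment> \<open>At the point (\<alpha>^2 : \<alpha> \<beta> : \<beta>^2 : 0) of the conic the
    first two coordinates are proportional to (\<alpha>, \<beta>), and away from the two removed
    points both are nonzero.\<close>
  define \<Phi> where "\<Phi> = pencil_pullback M \<omega>\<^sub>1 \<omega>\<^sub>3 (\<lambda>x :: complex ^ 4. x $ 1) (\<lambda>x. x $ 2)"
  define A B C E F G H where K_defs: "A = coef21 2 3" "B = coef21 2 4" "C = coef111 1 2 4"
    "E = coef21 3 2" "F = coef21 4 1" "G = coef111 2 3 4" "H = coef21 4 2"
  define \<Phi>' where "\<Phi>' = (\<lambda>\<zeta>.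
    (vector [A \<zeta> * C \<zeta> * C \<zeta>, A \<zeta> * C \<zeta> * G \<zeta> + 3/2 * (A \<zeta> * A \<zeta> * F \<zeta>) - B \<zeta> * C \<zeta> * E \<zeta>,
      1/3 * (A \<zeta> * C \<zeta> * H \<zeta>) + 1/6 * (A \<zeta> * B \<zeta> * F \<zeta>), 1/2 * (C \<zeta> * C \<zeta> * E \<zeta>),
      (-1/2) * (A \<zeta> * C \<zeta> * F \<zeta>), - 1 * (B \<zeta> * C \<zeta> * C \<zeta>)] :: complex ^ 6,
     vector [A \<zeta> * A \<zeta>, A \<zeta> * C \<zeta>, C \<zeta> * C \<zeta>, 0 * (A \<zeta> * A \<zeta>)] :: complex ^ 4))"
  have hK: "homog form_space 1 A" "homog form_space 1 B" "homog form_space 1 C" "homog form_space 1 E"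
    "homog form_space 1 F" "homog form_space 1 G" "homog form_space 1 H"
    unfolding K_defs by (rule homog_coef)+
  have coef: "A (scale_form c (\<Phi> (y, x))) = c * (x $ 1 * y $ 1 ^ 4)"
    "B (scale_form c (\<Phi> (y, x))) = c * (- x $ 1 * y $ 6 * y $ 1 ^ 3)"
    "C (scale_form c (\<Phi> (y, x))) = c * (x $ 2 * y $ 1 ^ 4)"
    "E (scale_form c (\<Phi> (y, x))) = c * (2 * x $ 1 * y $ 4 * y $ 1 ^ 3)"
    "F (scale_form c (\<Phi> (y, x))) = c * (- 2 * x $ 2 * y $ 5 * y $ 1 ^ 3)"
    "G (scale_form c (\<Phi> (y, x))) = c * (x $ 1 * (3 * y $ 5 * y $ 1 ^ 3 - 2 * y $ 6 * y $ 4 * (y $ 1)\<^sup>2)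
      + x $ 2 * y $ 2 * y $ 1 ^ 3)"
    "H (scale_form c (\<Phi> (y, x))) =
      c * (3 * x $ 2 * y $ 3 * y $ 1 ^ 3 - x $ 1 * y $ 5 * y $ 6 * (y $ 1)\<^sup>2)" for c x y
    unfolding K_defs \<Phi>_def M_def pencil_pullback_def prod.case coef_scale coef_pencil_13 by (rule refl)+
  show ?thesis
  proof (rule orbit_isomorphism[where M = M and \<Phi>' = \<Phi>' and \<kappa> = "\<lambda>\<zeta>. A \<zeta> * C \<zeta>"
        and \<eta> = \<omega>\<^sub>1 and \<theta> = \<omega>\<^sub>3 and \<alpha> = "\<lambda>x. x $ 1" and \<beta> = "\<lambda>x. x $ 2", folded \<Phi>_def])
    show "homog Proj 2 (\<lambda>x :: complex ^ 4. x $ 1 * x $ 3)"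
      by (intro homog_times2 homog_nth)
    show "homog Proj 2 (\<lambda>x :: complex ^ 4. x $ 1 * x $ 3 - x $ 2 * x $ 2)"
      by (intro homog_diff homog_times2 homog_nth)
    show "homog Proj 1 (\<lambda>y. M y $ i $ j)" for i j
      unfolding M_def by (intro homog_upper homog_nth homog_zero[OF homog_nth])
    show "homog_lift form_space P5_P3 (\<lambda>(i, j). i * 3 + j * 2) \<Phi>'"
      unfolding \<Phi>'_def
      by (intro homog_lift_vectors homog.add homog_diff homog_cmult homog_times3 homog_times2 hK)
    show "homog form_space 2 (\<lambda>\<zeta>. A \<zeta> * C \<zeta>)" by (intro homog_times2 hK)
    show "A 0 * C 0 = 0" unfolding K_defs coef_zero by simp
  next
    fix g assume "g \<in> P"
    then obtain a b c d k m n q s p where g: "g = upper a b c d k m n q s p" and "a * b * c * d = 1"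
      unfolding P_iff by blast
    then have nz: "a \<noteq> 0" "b \<noteq> 0" "c \<noteq> 0" "d \<noteq> 0" by auto
    \<comment> \<open>The same parameter also occurs at the entry (3, 4) of the stabilizer, whence
      the correction in \<open>p'\<close>.\<close>
    define r where "r = k / b"
    define p' q' s' where "p' = (p - r * d) / c" "q' = q / b" "s' = s / b"
    define m' n' where "m' = (m - r * b * q') / a" "n' = (n - r * b * s') / a"
    let ?y = "vector [1, m', n', q', s', p'] :: complex ^ 6"
    \<comment> \<open>The third coordinate is forced by the equation of the conic.\<close>
    let ?x = "vector [b\<^sup>2 * c * d, a * b * d\<^sup>2, (a * b * d\<^sup>2)\<^sup>2 / (b\<^sup>2 * c * d), 0] :: complex ^ 4"
    have "g = upper a b c d (r * b) 0 0 0 0 (r * d) ** M ?y"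
      unfolding g M_def vector_6 upper_mult using nz
      by (simp add: r_def p'_q'_s'_def m'_n'_def)
    then have "pullback g (\<omega>\<^sub>1 + \<omega>\<^sub>3) = \<Phi> (?y, ?x)"
      by (simp only: pullback_mult pullback_stabilizer_13 \<Phi>_def pencil_pullback_def prod.case vector_4)
    then show "\<exists>y x. y $ 1 \<noteq> 0 \<and> x $ 1 * x $ 3 \<noteq> 0 \<and> x $ 4 = 0 \<and> x $ 1 * x $ 3 - x $ 2 * x $ 2 = 0 \<and>
        pullback g (\<omega>\<^sub>1 + \<omega>\<^sub>3) = \<Phi> (y, x)"
      using nz by (intro exI[of _ ?y] exI[of _ ?x]) (simp add: power2_eq_square)
  next
    fix y :: "complex ^ 6" and x :: "complex ^ 4"
    assume y: "y $ 1 \<noteq> 0" and x: "x $ 1 * x $ 3 \<noteq> 0" and x4: "x $ 4 = 0"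
      and "x $ 1 * x $ 3 - x $ 2 * x $ 2 = 0"
    then have sq: "x $ 1 * x $ 3 = x $ 2 * x $ 2" by simp
    with x have x2: "x $ 2 \<noteq> 0" by auto
    show "\<exists>g\<in>P. \<exists>c. c \<noteq> 0 \<and> \<Phi> (y, x) = scale_form c (pullback g (\<omega>\<^sub>1 + \<omega>\<^sub>3))"
      unfolding \<Phi>_def pencil_pullback_def prod.case M_def
    proof (rule pencil_in_orbit[OF _ _ y])
      \<comment> \<open>The weights b^2 c d and a b d^2 have ratio a d / (b c), which equals (a d)^2
        when the determinant is one; hence the square root.\<close>
      let ?e = "csqrt (x $ 2 / x $ 1)"
      show "pullback (upper 1 1 (1 / ?e) ?e 0 0 0 0 0 0) (\<omega>\<^sub>1 + \<omega>\<^sub>3) =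
          scale_form 1 \<omega>\<^sub>1 + scale_form (x $ 2 / x $ 1) \<omega>\<^sub>3"
        using pullback_stabilizer_13[of 1 1 "1 / ?e" ?e 0] x x2 by simp
    qed (use x x2 in auto)
    show "A (\<Phi> (y, x)) * C (\<Phi> (y, x)) \<noteq> 0"
      using coef(1,3)[of 1 y x] x x2 y by (simp add: scale_form_def)
    fix c :: complex assume c: "c \<noteq> 0"
    \<comment> \<open>Here A C C and A A determine the two factors. The third coordinate C C of the
      conic agrees only by means of \<open>sq\<close>.\<close>
    have "\<Phi>' (scale_form c (\<Phi> (y, x))) =
        ((c ^ 3 * x $ 1 * (x $ 2)\<^sup>2 * y $ 1 ^ 11) *s y, (c\<^sup>2 * x $ 1 * y $ 1 ^ 8) *s x)"
      unfolding \<Phi>'_def coef prod.inject vec_eq_4 vec_eq_6 vector_4 vector_6 vector_smult_component x4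
      by (intro conjI; (algebra | (use sq in algebra)
          | simp add: field_simps power2_eq_square power3_eq_cube))
    moreover have "c ^ 3 * x $ 1 * (x $ 2)\<^sup>2 * y $ 1 ^ 11 \<noteq> 0" "c\<^sup>2 * x $ 1 * y $ 1 ^ 8 \<noteq> 0"
      using c x x2 y by simp_all
    ultimately show "\<exists>a b. a \<noteq> 0 \<and> b \<noteq> 0 \<and> \<Phi>' (scale_form c (\<Phi> (y, x))) = (a *s y, b *s x)"
      by blast
  next
    fix \<zeta> assume "A \<zeta> * C \<zeta> \<noteq> 0"
    then show "fst (\<Phi>' \<zeta>) $ 1 \<noteq> 0 \<and> snd (\<Phi>' \<zeta>) $ 1 * snd (\<Phi>' \<zeta>) $ 3 \<noteq> 0 \<and> snd (\<Phi>' \<zeta>) $ 4 = 0 \<and>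
        snd (\<Phi>' \<zeta>) $ 1 * snd (\<Phi>' \<zeta>) $ 3 - snd (\<Phi>' \<zeta>) $ 2 * snd (\<Phi>' \<zeta>) $ 2 = 0"
      by (simp add: \<Phi>'_def)
  qed (use homog_nth in auto)
qed

lemma orbit_23:
  "isomorphic_varieties form_space (P_orbit (\<omega>\<^sub>2 + \<omega>\<^sub>3)) P5_P3
     (cone_points (\<lambda>x. x $ 1 * x $ 4) (\<lambda>x. x $ 2) (\<lambda>x. x $ 3))"
proof -
  define M where "M = (\<lambda>y :: complex ^ 6.
    upper (y $ 1) (y $ 1) (y $ 1) (y $ 1) (y $ 2) (y $ 3) (y $ 4) (y $ 5) (y $ 6) 0)"
  define \<Phi> where "\<Phi> = pencil_pullback M \<omega>\<^sub>2 \<omega>\<^sub>3 (\<lambda>x :: complex ^ 4. x $ 1) (\<lambda>x. x $ 4)"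
  define A B C E F G H where K_defs: "A = coef21 3 1" "B = coef21 3 2" "C = coef3 3"
    "E = coef21 3 4" "F = coef111 1 2 4" "G = coef111 1 3 4" "H = coef21 4 1"
  define \<Phi>' where "\<Phi>' = (\<lambda>\<zeta>.
    (vector [A \<zeta> * A \<zeta> * F \<zeta>, A \<zeta> * B \<zeta> * F \<zeta>, A \<zeta> * C \<zeta> * F \<zeta>,
      2/3 * (A \<zeta> * E \<zeta> * F \<zeta> - C \<zeta> * F \<zeta> * G \<zeta>), A \<zeta> * A \<zeta> * G \<zeta>,
      (-1/2) * (A \<zeta> * A \<zeta> * H \<zeta>)] :: complex ^ 6,
     vector [(-1/2) * A \<zeta>, 0 * A \<zeta>, 0 * A \<zeta>, F \<zeta>] :: complex ^ 4))"
  have hK: "homog form_space 1 A" "homog form_space 1 B" "homog form_space 1 C" "homog form_space 1 E"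
    "homog form_space 1 F" "homog form_space 1 G" "homog form_space 1 H"
    unfolding K_defs by (rule homog_coef)+
  have coef: "A (scale_form c (\<Phi> (y, x))) = c * (- 2 * x $ 1 * y $ 1 ^ 4)"
    "B (scale_form c (\<Phi> (y, x))) = c * (- 2 * x $ 1 * y $ 2 * y $ 1 ^ 3)"
    "C (scale_form c (\<Phi> (y, x))) = c * (- 2 * x $ 1 * y $ 3 * y $ 1 ^ 3)"
    "E (scale_form c (\<Phi> (y, x))) =
      c * (- 3 * x $ 1 * y $ 4 * y $ 1 ^ 3 + x $ 4 * y $ 5 * y $ 3 * (y $ 1)\<^sup>2)"
    "F (scale_form c (\<Phi> (y, x))) = c * (x $ 4 * y $ 1 ^ 4)"
    "G (scale_form c (\<Phi> (y, x))) = c * (x $ 4 * y $ 5 * y $ 1 ^ 3)"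
    "H (scale_form c (\<Phi> (y, x))) = c * (- 2 * x $ 4 * y $ 6 * y $ 1 ^ 3)" for c x y
    unfolding K_defs \<Phi>_def M_def pencil_pullback_def prod.case coef_scale coef_pencil_23 by (rule refl)+
  show ?thesis
  proof (rule orbit_isomorphism[where M = M and \<Phi>' = \<Phi>' and \<kappa> = "\<lambda>\<zeta>. A \<zeta> * F \<zeta>"
        and \<eta> = \<omega>\<^sub>2 and \<theta> = \<omega>\<^sub>3 and \<alpha> = "\<lambda>x. x $ 1" and \<beta> = "\<lambda>x. x $ 4", folded \<Phi>_def])
    show "homog Proj 2 (\<lambda>x :: complex ^ 4. x $ 1 * x $ 4)"
      by (intro homog_times2 homog_nth)
    show "homog Proj 1 (\<lambda>y. M y $ i $ j)" for i j
      unfolding M_def by (intro homog_upper homog_nth homog_zero[OF homog_nth])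
    show "homog_lift form_space P5_P3 (\<lambda>(i, j). i * 3 + j * 1) \<Phi>'"
      unfolding \<Phi>'_def
      by (intro homog_lift_vectors homog.add homog_diff homog_cmult homog_times3 hK)
    show "homog form_space 2 (\<lambda>\<zeta>. A \<zeta> * F \<zeta>)" by (intro homog_times2 hK)
    show "A 0 * F 0 = 0" unfolding K_defs coef_zero by simp
  next
    fix g assume "g \<in> P"
    then obtain a b c d k m n q s p where g: "g = upper a b c d k m n q s p" and "a * b * c * d = 1"
      unfolding P_iff by blast
    then have nz: "a \<noteq> 0" "b \<noteq> 0" "c \<noteq> 0" "d \<noteq> 0" by auto
    \<comment> \<open>The parametrising matrix has no entry (3, 4), so the stabilizer must produce
      \<open>p\<close>; this affects only the second row of the remaining entries.\<close>
    define r where "r = p / d"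
    let ?y = "vector [1, k / a, m / a, n / a, (q - r * c) / b, (s - r\<^sup>2 / 2 * d) / b] :: complex ^ 6"
    let ?x = "vector [a * c\<^sup>2 * d, 0, 0, a * b * d\<^sup>2] :: complex ^ 4"
    have "g = upper a b c d 0 0 0 (r * c) (r\<^sup>2 / 2 * d) (r * d) ** M ?y"
      unfolding g M_def vector_6 upper_mult using nz by (simp add: r_def)
    then have "pullback g (\<omega>\<^sub>2 + \<omega>\<^sub>3) = \<Phi> (?y, ?x)"
      by (simp only: pullback_mult pullback_stabilizer_23 \<Phi>_def pencil_pullback_def prod.case vector_4)
    then show "\<exists>y x. y $ 1 \<noteq> 0 \<and> x $ 1 * x $ 4 \<noteq> 0 \<and> x $ 2 = 0 \<and> x $ 3 = 0 \<and>
        pullback g (\<omega>\<^sub>2 + \<omega>\<^sub>3) = \<Phi> (y, x)"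
      using nz by (intro exI[of _ ?y] exI[of _ ?x]) simp
  next
    fix y :: "complex ^ 6" and x :: "complex ^ 4"
    assume y: "y $ 1 \<noteq> 0" and x: "x $ 1 * x $ 4 \<noteq> 0" and x23: "x $ 2 = 0" "x $ 3 = 0"
    show "\<exists>g\<in>P. \<exists>c. c \<noteq> 0 \<and> \<Phi> (y, x) = scale_form c (pullback g (\<omega>\<^sub>2 + \<omega>\<^sub>3))"
      unfolding \<Phi>_def pencil_pullback_def prod.case M_def
    proof (rule pencil_in_orbit[OF _ _ y])
      \<comment> \<open>The weights a c^2 d and a b d^2 are x_1 / x_4 and 1, and the common factor
        is x_4.\<close>
      show "pullback (upper (x $ 1 / x $ 4) (x $ 4 / x $ 1) 1 1 0 0 0 0 0 0) (\<omega>\<^sub>2 + \<omega>\<^sub>3) =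
          scale_form (x $ 1 / x $ 4) \<omega>\<^sub>2 + scale_form 1 \<omega>\<^sub>3"
        using pullback_stabilizer_23[of "x $ 1 / x $ 4" "x $ 4 / x $ 1" 1 1 0] x by simp
    qed (use x in auto)
    show "A (\<Phi> (y, x)) * F (\<Phi> (y, x)) \<noteq> 0"
      using coef(1,5)[of 1 y x] x y by (simp add: scale_form_def)
    fix c :: complex assume c: "c \<noteq> 0"
    have "\<Phi>' (scale_form c (\<Phi> (y, x))) =
        ((4 * c ^ 3 * (x $ 1)\<^sup>2 * x $ 4 * y $ 1 ^ 11) *s y, (c * y $ 1 ^ 4) *s x)"
      unfolding \<Phi>'_def coef prod.inject vec_eq_4 vec_eq_6 vector_4 vector_6 vector_smult_component x23
      by (intro conjI; (algebra | simp add: field_simps power2_eq_square power3_eq_cube))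
    moreover have "4 * c ^ 3 * (x $ 1)\<^sup>2 * x $ 4 * y $ 1 ^ 11 \<noteq> 0" "c * y $ 1 ^ 4 \<noteq> 0"
      using c x y by simp_all
    ultimately show "\<exists>a b. a \<noteq> 0 \<and> b \<noteq> 0 \<and> \<Phi>' (scale_form c (\<Phi> (y, x))) = (a *s y, b *s x)"
      by blast
  next
    fix \<zeta> assume "A \<zeta> * F \<zeta> \<noteq> 0"
    then show "fst (\<Phi>' \<zeta>) $ 1 \<noteq> 0 \<and> snd (\<Phi>' \<zeta>) $ 1 * snd (\<Phi>' \<zeta>) $ 4 \<noteq> 0 \<and>
        snd (\<Phi>' \<zeta>) $ 2 = 0 \<and> snd (\<Phi>' \<zeta>) $ 3 = 0"
      by (simp add: \<Phi>'_def)
  qed (use homog_nth in auto)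
qed

section \<open>The boundary components\<close>

lemma A5_cone:
  "A5 \<boxtimes> {proj_class (*s) x | x. F x \<noteq> 0 \<and> G x = 0 \<and> H x = 0} = cone_points F G H"
  unfolding A5_def point_prod_def cone_points_def by blast

lemma pt_eq_scale: "c \<noteq> 0 \<Longrightarrow> pt (c * u) (c * v) (c * w) (c * z) = pt u v w z"
  unfolding pt_def by (rule proj_class_eqI[OF vector_space_vec, of _ c]) (auto simp: vec_eq_4)

lemma proj_class_pt: "proj_class (*s) x = pt (x $ 1) (x $ 2) (x $ 3) (x $ 4)"
  unfolding pt_def by (rule arg_cong[where f = "proj_class (*s)"]) (simp add: vec_eq_4)

text \<open>This separates points: a coordinate that is nonzero at \<open>x\<close> but zero in the
  given tuple excludes equality.\<close>

lemma proj_class_eq_ptD: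
  assumes "proj_class (*s) x = pt u v w z"
  shows "\<exists>c. x $ 1 = c * u \<and> x $ 2 = c * v \<and> x $ 3 = c * w \<and> x $ 4 = c * z"
proof -
  have "x \<in> proj_class (*s) (vector [u, v, w, z])"
    using assms proj_class_self[OF vector_space_vec, of x] by (simp add: pt_def)
  then show ?thesis by (auto simp: proj_class_def)
qed

lemma L_u_open: "L\<^sub>u - {pt 0 0 1 0, pt 0 0 0 1} =
    {proj_class (*s) (x :: complex ^ 4) | x. x $ 3 * x $ 4 \<noteq> 0 \<and> x $ 1 = 0 \<and> x $ 2 = 0}"
proof (intro equalityI subsetI)
  fix p assume p: "p \<in> L\<^sub>u - {pt 0 0 1 0, pt 0 0 0 1}"
  then obtain w z where wz: "p = pt 0 0 w z" "(w, z) \<noteq> (0, 0)" unfolding L\<^sub>u_def by blast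
  then have "w \<noteq> 0" "z \<noteq> 0"
    using p pt_eq_scale[of w 0 0 1 0] pt_eq_scale[of z 0 0 0 1] by auto
  then show "p \<in> {proj_class (*s) (x :: complex ^ 4) | x. x $ 3 * x $ 4 \<noteq> 0 \<and> x $ 1 = 0 \<and> x $ 2 = 0}"
    using wz(1) unfolding pt_def
    by (intro CollectI exI[of _ "vector [0, 0, w, z]"]) simp
next
  fix p assume "p \<in> {proj_class (*s) (x :: complex ^ 4) | x. x $ 3 * x $ 4 \<noteq> 0 \<and> x $ 1 = 0 \<and> x $ 2 = 0}"
  then obtain x where x: "p = proj_class (*s) x" "x $ 3 * x $ 4 \<noteq> 0" "x $ 1 = 0" "x $ 2 = 0"
    by blast
  then have "p = pt 0 0 (x $ 3) (x $ 4)" using proj_class_pt[of x] by simp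
  then have "p \<in> L\<^sub>u" using x(2) unfolding L\<^sub>u_def by fastforce
  moreover have "p \<noteq> pt 0 0 1 0" "p \<noteq> pt 0 0 0 1" using proj_class_eq_ptD x by fastforce+
  ultimately show "p \<in> L\<^sub>u - {pt 0 0 1 0, pt 0 0 0 1}" by simp
qed

lemma L_w_open: "L\<^sub>w - {pt 0 0 0 1, pt 1 0 0 0} =
    {proj_class (*s) (x :: complex ^ 4) | x. x $ 1 * x $ 4 \<noteq> 0 \<and> x $ 2 = 0 \<and> x $ 3 = 0}"
proof (intro equalityI subsetI)
  fix p assume p: "p \<in> L\<^sub>w - {pt 0 0 0 1, pt 1 0 0 0}"
  then obtain u z where uz: "p = pt u 0 0 z" "(u, z) \<noteq> (0, 0)" unfolding L\<^sub>w_def by blast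
  then have "u \<noteq> 0" "z \<noteq> 0"
    using p pt_eq_scale[of u 1 0 0 0] pt_eq_scale[of z 0 0 0 1] by auto
  then show "p \<in> {proj_class (*s) (x :: complex ^ 4) | x. x $ 1 * x $ 4 \<noteq> 0 \<and> x $ 2 = 0 \<and> x $ 3 = 0}"
    using uz(1) unfolding pt_def
    by (intro CollectI exI[of _ "vector [u, 0, 0, z]"]) simp
next
  fix p assume "p \<in> {proj_class (*s) (x :: complex ^ 4) | x. x $ 1 * x $ 4 \<noteq> 0 \<and> x $ 2 = 0 \<and> x $ 3 = 0}"
  then obtain x where x: "p = proj_class (*s) x" "x $ 1 * x $ 4 \<noteq> 0" "x $ 2 = 0" "x $ 3 = 0"
    by blast
  then have "p = pt (x $ 1) 0 0 (x $ 4)" using proj_class_pt[of x] by simp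
  then have "p \<in> L\<^sub>w" using x(2) unfolding L\<^sub>w_def by fastforce
  moreover have "p \<noteq> pt 0 0 0 1" "p \<noteq> pt 1 0 0 0" using proj_class_eq_ptD x by fastforce+
  ultimately show "p \<in> L\<^sub>w - {pt 0 0 0 1, pt 1 0 0 0}" by simp
qed

lemma C_inf_open: "C_inf - {pt 0 0 1 0, pt 1 0 0 0} =
    {proj_class (*s) (x :: complex ^ 4) | x. x $ 1 * x $ 3 \<noteq> 0 \<and> x $ 4 = 0 \<and> x $ 1 * x $ 3 - x $ 2 * x $ 2 = 0}"
    (is "_ = ?R")
proof (intro equalityI subsetI)
  fix p assume p: "p \<in> C_inf - {pt 0 0 1 0, pt 1 0 0 0}"
  then obtain u v w where uvw: "p = pt u v w 0" "(u, v, w) \<noteq> (0, 0, 0)" "u * w = v\<^sup>2"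
    unfolding C_inf_def by blast
  have "u \<noteq> 0" "w \<noteq> 0"
  proof -
    \<comment> \<open>On the conic, vanishing of \<open>u\<close> or \<open>w\<close> forces
      \<open>v = 0\<close>, which leaves exactly the two removed points.\<close>
    have "v = 0" if "u = 0 \<or> w = 0" using uvw(3) that by auto
    then show "u \<noteq> 0" "w \<noteq> 0"
      using p uvw(1,2) pt_eq_scale[of u 1 0 0 0] pt_eq_scale[of w 0 0 1 0] by auto
  qed
  moreover from this have "v \<noteq> 0" using uvw(3) by auto
  ultimately show "p \<in> ?R"
    using uvw(1,3) unfolding pt_def
    by (intro CollectI exI[of _ "vector [u, v, w, 0]"]) (simp add: power2_eq_square)
next
  fix p assume "p \<in> ?R"
  then obtain x where x: "p = proj_class (*s) x" "x $ 1 * x $ 3 \<noteq> 0" "x $ 4 = 0"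
      "x $ 1 * x $ 3 - x $ 2 * x $ 2 = 0"
    by blast
  then have "p = pt (x $ 1) (x $ 2) (x $ 3) 0" using proj_class_pt[of x] by simp
  then have "p \<in> C_inf" using x(2,4) unfolding C_inf_def
    by (intro CollectI exI[of _ "x $ 1"] exI[of _ "x $ 2"] exI[of _ "x $ 3"]) (simp add: power2_eq_square)
  moreover have "p \<noteq> pt 0 0 1 0" "p \<noteq> pt 1 0 0 0" using proj_class_eq_ptD x by fastforce+
  ultimately show "p \<in> C_inf - {pt 0 0 1 0, pt 1 0 0 0}" by simp
qed

lemma A5_prod_subset: "A5 \<boxtimes> (X - Y) \<subseteq> P5 \<boxtimes> X"
  unfolding point_prod_def A5_def points_projective_space by fastforce

theorem theorem10:
  shows
    "(isomorphic_varieties form_space (P_orbit (\<omega>\<^sub>1 + \<omega>\<^sub>2))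
        P5_P3 (A5 \<boxtimes> (L\<^sub>u - {pt 0 0 1 0, pt 0 0 0 1}))
      \<and> A5 \<boxtimes> (L\<^sub>u - {pt 0 0 1 0, pt 0 0 0 1}) \<subseteq> Z\<^sub>1) \<and>
     (isomorphic_varieties form_space (P_orbit (\<omega>\<^sub>2 + \<omega>\<^sub>3))
        P5_P3 (A5 \<boxtimes> (L\<^sub>w - {pt 0 0 0 1, pt 1 0 0 0}))
      \<and> A5 \<boxtimes> (L\<^sub>w - {pt 0 0 0 1, pt 1 0 0 0}) \<subseteq> Z\<^sub>3) \<and>
     (isomorphic_varieties form_space (P_orbit (\<omega>\<^sub>1 + \<omega>\<^sub>3))
        P5_P3 (A5 \<boxtimes> (C_inf - {pt 0 0 1 0, pt 1 0 0 0}))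
      \<and> A5 \<boxtimes> (C_inf - {pt 0 0 1 0, pt 1 0 0 0}) \<subseteq> Z\<^sub>2)"
  unfolding Z\<^sub>1_def Z\<^sub>2_def Z\<^sub>3_def
  using orbit_12 orbit_23 orbit_13
  unfolding A5_cone[symmetric] L_u_open[symmetric] L_w_open[symmetric] C_inf_open[symmetric]
  by (intro conjI A5_prod_subset)

end
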